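(* Let $n\ge 2$ and let $M=[0,\infty)\times\mathbb{S}^{n-1}$ be an $n$-dimensional model manifold with metric $g_M=dt^2+r^2(t)\,g_{\mathbb{S}^{n-1}}$. Suppose there is a constant $c$ such that $0<r'(t)\le c$ for all $t\ge 0$. Then the spectrum of the Laplace operator on $M$ is $\sigma(M)=[0,\infty)$.
   Context: Model manifold: the smooth complete rotationally symmetric Riemannian manifold obtained from $[0,\infty)\times\mathbb{S}^{n-1}$ by collapsing $\{0\}\times\mathbb{S}^{n-1}$ to a single point (the pole), whose metric in the polar coordinates $(t,\omega)$, $t>0$, is $dt^2+r(t)^2 g_{\mathbb{S}^{n-1}}$, where $g_{\mathbb{S}^{n-1}}$ is the standard round metric of the unit sphere and $r:[0,\infty)\to[0,\infty)$ is smooth with $r(0)=0$, $r(t)>0$ for $t>0$, and such that the metric extends smoothly across the pole (in particular $r'(0)=1$). For a complete Riemannian manifold $M$, $\Delta=\mathrm{div}\circ\mathrm{grad}$ acting on $C_0^\infty(M)$ has a unique self-adjoint extension, still denoted $\Delta$, to an unbounded operator on $L^2(M)$ with domain $\{f\in L^2(M):\Delta f\in L^2(M)\}$. The spectrum of (the Laplace operator on) $M$, denoted $\sigma(M)$, is the spectrum of $-\Delta$, i.e. the set of $\lambda\ge 0$ such that $\Delta+\lambda I$ does not have a bounded inverse. *)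

theory Defs
  imports "HOL-Analysis.Analysis"
begin

section \<open>Smooth functions\<close>

definition partial :: "'n \<Rightarrow> (real^'n \<Rightarrow> real) \<Rightarrow> real^'n \<Rightarrow> real" where
  "partial i f x = frechet_derivative f (at x) (axis i 1)"

primrec C_k :: "nat \<Rightarrow> (real^'n \<Rightarrow> real) \<Rightarrow> bool" where
  "C_k 0 f \<longleftrightarrow> continuous_on UNIV f"
| "C_k (Suc k) f \<longleftrightarrow> (\<forall>x. f differentiable (at x)) \<and> (\<forall>i. C_k k (partial i f))"

definition smooth :: "(real^'n \<Rightarrow> real) \<Rightarrow> bool" where
  "smooth f \<longleftrightarrow> (\<forall>k. C_k k f)"

definition test_function :: "(real^'n \<Rightarrow> real) \<Rightarrow> bool" where
  "test_function \<phi> \<longleftrightarrow> smooth \<phi> \<and> compact (closure {x. \<phi> x \<noteq> 0})"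

text \<open>Derivatives at the endpoint \<open>0\<close> are one-sided.\<close>

definition smooth_on_halfline :: "(real \<Rightarrow> real) \<Rightarrow> bool" where
  "smooth_on_halfline r \<longleftrightarrow>
     (\<exists>D :: nat \<Rightarrow> real \<Rightarrow> real. D 0 = r \<and>
        (\<forall>k. \<forall>t\<ge>0. (D k has_real_derivative D (Suc k) t) (at t within {0..})))"

section \<open>Riemannian metrics in a global chart\<close>

text \<open>The matrix \<open>G x\<close> holds the components \<open>g\<^sub>i\<^sub>j\<close> of the metric at \<open>x\<close>.\<close>

definition riemannian_metric :: "(real^'n \<Rightarrow> real^'n^'n) \<Rightarrow> bool" where
  "riemannian_metric G \<longleftrightarrow>
     (\<forall>i j. smooth (\<lambda>x. G x $ i $ j)) \<and>
     (\<forall>x. transpose (G x) = G x) \<and>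
     (\<forall>x v. v \<noteq> 0 \<longrightarrow> v \<bullet> (G x *v v) > 0)"

definition volume_measure :: "(real^'n \<Rightarrow> real^'n^'n) \<Rightarrow> (real^'n) measure" where
  "volume_measure G = density lborel (\<lambda>x. ennreal (sqrt (det (G x))))"

definition gradient :: "(real^'n \<Rightarrow> real^'n^'n) \<Rightarrow> (real^'n \<Rightarrow> real) \<Rightarrow> real^'n \<Rightarrow> real^'n" where
  "gradient G f x = matrix_inv (G x) *v (\<chi> i. partial i f x)"

definition divergence :: "(real^'n \<Rightarrow> real^'n^'n) \<Rightarrow> (real^'n \<Rightarrow> real^'n) \<Rightarrow> real^'n \<Rightarrow> real" where
  "divergence G X x =
     (\<Sum>i\<in>UNIV. partial i (\<lambda>y. sqrt (det (G y)) * X y $ i) x) / sqrt (det (G x))"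

definition laplacian :: "(real^'n \<Rightarrow> real^'n^'n) \<Rightarrow> (real^'n \<Rightarrow> real) \<Rightarrow> real^'n \<Rightarrow> real" where
  "laplacian G f = divergence G (gradient G f)"

section \<open>Model manifolds\<close>

text \<open>
  The model manifold is \<open>\<real>\<^sup>n\<close> with pole \<open>0\<close> and polar coordinates \<open>t = norm x\<close>,
  \<open>\<omega> = sgn x = x / norm x\<close>. The form below is \<open>dt\<^sup>2 + r(t)\<^sup>2 g\<close>, with \<open>g\<close> the
  metric induced on the unit sphere by the Euclidean inner product, evaluated at \<open>v\<close>, \<open>w\<close>.
\<close>

definition polar_metric :: "(real \<Rightarrow> real) \<Rightarrow> real^'n \<Rightarrow> real^'n \<Rightarrow> real^'n \<Rightarrow> real" where
  "polar_metric r x v w =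
     frechet_derivative norm (at x) v * frechet_derivative norm (at x) w +
     (r (norm x))\<^sup>2 * (frechet_derivative sgn (at x) v \<bullet> frechet_derivative sgn (at x) w)"

text \<open>
  Since \<open>G\<close> is a smooth metric on the whole space, the last condition says that the polar
  metric extends smoothly across the pole. The extension is unique by continuity, and for
  \<open>n \<ge> 2\<close> its existence forces \<open>r'(0) = 1\<close>.
\<close>

definition model_manifold :: "(real \<Rightarrow> real) \<Rightarrow> (real^'n \<Rightarrow> real^'n^'n) \<Rightarrow> bool" where
  "model_manifold r G \<longleftrightarrow>
     smooth_on_halfline r \<and> r 0 = 0 \<and> (\<forall>t>0. r t > 0) \<and>
     riemannian_metric G \<and>
     (\<forall>x v w. x \<noteq> 0 \<longrightarrow> v \<bullet> (G x *v w) = polar_metric r x v w)"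

section \<open>The spectrum\<close>

text \<open>Elements of \<open>L\<^sup>2\<close> are represented by functions, identified almost everywhere.\<close>

definition L2 :: "'a measure \<Rightarrow> ('a \<Rightarrow> complex) set" where
  "L2 N = {f \<in> borel_measurable N. integrable N (\<lambda>x. (cmod (f x))\<^sup>2)}"

definition L2_norm :: "'a measure \<Rightarrow> ('a \<Rightarrow> complex) \<Rightarrow> real" where
  "L2_norm N f = sqrt (\<integral>x. (cmod (f x))\<^sup>2 \<partial>N)"

text \<open>
  The graph of \<open>\<Delta>\<close> on \<open>{f \<in> L\<^sup>2. \<Delta> f \<in> L\<^sup>2}\<close>, where \<open>\<Delta> f\<close> is taken in the sense of
  distributions: the pair \<open>f\<close>, \<open>h\<close> is related iff \<open>f\<close> is in this domain and \<open>\<Delta> f = h\<close>.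
  On a complete manifold this is the unique self-adjoint extension of \<open>\<Delta>\<close> from \<open>C\<^sub>0\<^sup>\<infinity>\<close>.
  As \<open>\<Delta>\<close> is a real operator, real-valued test functions suffice for complex-valued \<open>f\<close>.
\<close>

definition laplace_graph ::
  "(real^'n \<Rightarrow> real^'n^'n) \<Rightarrow> (real^'n \<Rightarrow> complex) \<Rightarrow> (real^'n \<Rightarrow> complex) \<Rightarrow> bool" where
  "laplace_graph G f h \<longleftrightarrow>
     f \<in> L2 (volume_measure G) \<and> h \<in> L2 (volume_measure G) \<and>
     (\<forall>\<phi>. test_function \<phi> \<longrightarrow>
        (\<integral>x. f x * of_real (laplacian G \<phi> x) \<partial>volume_measure G) =
        (\<integral>x. h x * of_real (\<phi> x) \<partial>volume_measure G))"

text \<open>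
  An unbounded operator on \<open>L\<^sup>2\<close> is given by its graph \<open>T\<close>. The function \<open>R\<close> is a
  two-sided inverse up to null sets; it therefore respects almost everywhere equality, and it
  is linear whenever \<open>T\<close> is.
\<close>

definition has_bounded_inverse ::
  "'a measure \<Rightarrow> (('a \<Rightarrow> complex) \<Rightarrow> ('a \<Rightarrow> complex) \<Rightarrow> bool) \<Rightarrow> bool" where
  "has_bounded_inverse N T \<longleftrightarrow>
     (\<exists>R. (\<forall>h\<in>L2 N. R h \<in> L2 N \<and> T (R h) h) \<and>
          (\<forall>f h. T f h \<longrightarrow> (AE x in N. R h x = f x)) \<and>
          (\<exists>C. \<forall>h\<in>L2 N. L2_norm N (R h) \<le> C * L2_norm N h))"

text \<open>The relation passed below is the graph of \<open>\<Delta> + l I\<close>.\<close>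

definition laplace_spectrum :: "(real^'n \<Rightarrow> real^'n^'n) \<Rightarrow> real set" where
  "laplace_spectrum G =
     {l. l \<ge> 0 \<and>
        \<not> has_bounded_inverse (volume_measure G)
            (\<lambda>f h. laplace_graph G f (\<lambda>x. h x - of_real l * f x))}"

end

theory Submission
  imports Defs
begin

text \<open>
  If \<open>\<Delta> + l\<close> had a bounded inverse, then \<open>\<parallel>f\<parallel> \<le> C \<parallel>\<Delta> f + l f\<parallel>\<close> on the domain of \<open>\<Delta>\<close>. Test this on
  the radial functions \<open>u(t) = \<chi>(t) cos (k t + \<theta>)\<close> with \<open>k\<^sup>2 = l\<close>, \<open>\<theta> = 0\<close> and \<open>\<theta> = - \<pi> / 2\<close>, where
  \<open>\<chi>\<close> is a bump of height of order 1 on an interval \<open>[a, a + L]\<close>. There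
  \<open>\<Delta> u + l u = (u'' + l u) + (n - 1) (r' / r) u'\<close>: the first term is \<open>O(1 / L)\<close> and \<open>u'\<close> is bounded.
  Since \<open>r\<close> grows at most linearly, \<open>a \<ge> 1\<close> can be chosen with \<open>r (a + L) \<le> 2 r a\<close>. Then the
  volume density \<open>r\<^bsup>n - 1\<^esup>\<close> varies by at most the factor \<open>2\<^bsup>n - 1\<^esup>\<close> on the interval, and
  \<open>\<integral> (r' / r)\<^sup>2 \<le> c / r 1 * (r (a + L) - r a) / r a \<le> c / r 1\<close>. So, relative to \<open>r(a)\<^bsup>n - 1\<^esup>\<close>, the right hand
  side of the estimate stays bounded as \<open>L\<close> grows, while the left hand side, summed over both
  \<open>\<theta>\<close>, is at least a multiple of \<open>L\<close>.
\<close>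

section \<open>Continuously differentiable functions\<close>

text \<open>The waves used below are only C^2 and \<open>norm\<close> is singular at the pole, so
  the analysis runs in this class, mostly on \<open>-{0}\<close>, instead of in
  \<open>smooth\<close>. Differentiability is demanded separately, so that it need not be derived
  from continuity of the partial derivatives.\<close>

definition C1_on :: "(real^'n) set \<Rightarrow> (real^'n \<Rightarrow> real) \<Rightarrow> bool" where
  "C1_on S f \<longleftrightarrow> (\<forall>x\<in>S. f differentiable (at x)) \<and> (\<forall>i. continuous_on S (partial i f))"

lemma partial_eqI: "(f has_derivative D) (at x) \<Longrightarrow> partial i f x = D (axis i 1)"
  by (simp add: partial_def frechet_derivative_at[symmetric])

lemma has_derivative_partial:
  assumes "f differentiable (at x)"
  shows "(f has_derivative (\<lambda>v. \<Sum>i\<in>UNIV. v $ i * partial i f x)) (at x)"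
proof -
  have D: "(f has_derivative frechet_derivative f (at x)) (at x)"
    using assms frechet_derivative_works by blast
  then have lin: "linear (frechet_derivative f (at x))"
    by (rule has_derivative_linear)
  have "frechet_derivative f (at x) v = (\<Sum>i\<in>UNIV. v $ i * partial i f x)" for v
  proof -
    have "frechet_derivative f (at x) v = frechet_derivative f (at x) (\<Sum>i\<in>UNIV. v $ i *\<^sub>R axis i 1)"
      using basis_expansion[of v] by (simp add: scalar_mult_eq_scaleR)
    also have "\<dots> = (\<Sum>i\<in>UNIV. v $ i * partial i f x)"
      using lin by (simp add: linear_sum linear_scale partial_def)
    finally show ?thesis .
  qed
  then have "frechet_derivative f (at x) = (\<lambda>v. \<Sum>i\<in>UNIV. v $ i * partial i f x)"
    by blast
  with D show ?thesis by simp
qed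

lemma
  assumes "f differentiable (at x)" "g differentiable (at x)"
  shows partial_add: "partial i (\<lambda>x. f x + g x) x = partial i f x + partial i g x"
    and partial_diff: "partial i (\<lambda>x. f x - g x) x = partial i f x - partial i g x"
    and partial_mult: "partial i (\<lambda>x. f x * g x) x = f x * partial i g x + partial i f x * g x"
proof -
  note D = assms[unfolded frechet_derivative_works]
  show "partial i (\<lambda>x. f x + g x) x = partial i f x + partial i g x"
    by (rule partial_eqI[OF has_derivative_add[OF D], folded partial_def])
  show "partial i (\<lambda>x. f x - g x) x = partial i f x - partial i g x"
    by (rule partial_eqI[OF has_derivative_diff[OF D], folded partial_def])
  show "partial i (\<lambda>x. f x * g x) x = f x * partial i g x + partial i f x * g x"
    by (rule partial_eqI[OF has_derivative_mult[OF D], folded partial_def])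
qed

lemma partial_const: "partial i (\<lambda>x. c) x = 0"
  by (rule partial_eqI) simp

lemma partial_component:
  fixes x :: "real^'n"
  shows "partial i (\<lambda>x. x $ j) x = (if i = j then 1 else 0)"
proof -
  have "((\<lambda>x::real^'n. x $ j) has_derivative (\<lambda>x. x $ j)) (at x)"
    by (rule bounded_linear_imp_has_derivative) (rule bounded_linear_vec_nth)
  from partial_eqI[OF this] show ?thesis by (simp add: axis_def)
qed

text \<open>\<open>partial\<close> rests on a chosen derivative. At \<open>x\<close> both functions
  admit the same derivatives, so the choices coincide, even if no derivative exists.\<close>

lemma partial_cong_open:
  assumes "open S" "x \<in> S" "\<And>y. y \<in> S \<Longrightarrow> f y = g y"
  shows "partial i f x = partial i g x"
proof -
  have "(f has_derivative D) (at x) \<longleftrightarrow> (g has_derivative D) (at x)" for D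
    by (rule iffI; erule has_derivative_transform_within_open[OF _ assms(1,2)]) (simp_all add: assms(3))
  then show ?thesis by (simp add: partial_def frechet_derivative_def)
qed

lemma C1_on_cong:
  assumes "open S" "\<And>y. y \<in> S \<Longrightarrow> f y = g y" "C1_on S f"
  shows "C1_on S g"
proof -
  have "g differentiable (at x)" if x: "x \<in> S" for x
  proof -
    obtain D where "(f has_derivative D) (at x)"
      using assms(3) x unfolding C1_on_def differentiable_def by blast
    from has_derivative_transform_within_open[OF this assms(1) x assms(2)]
    show ?thesis by (rule differentiableI)
  qed
  moreover have "continuous_on S (partial i g)" for i
  proof (rule continuous_on_eq)
    show "continuous_on S (partial i f)" using assms(3) by (simp add: C1_on_def)
  qed (rule partial_cong_open[OF assms(1) _ assms(2)])
  ultimately show ?thesis by (simp add: C1_on_def)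
qed

lemma C1_onD: "C1_on S f \<Longrightarrow> x \<in> S \<Longrightarrow> f differentiable (at x)"
  and C1_on_partial: "C1_on S f \<Longrightarrow> continuous_on S (partial i f)"
  by (auto simp: C1_on_def)

lemma C1_on_continuous: "C1_on S f \<Longrightarrow> continuous_on S f"
  by (meson C1_onD continuous_at_imp_continuous_on differentiable_imp_continuous_within)

lemma C1_on_const: "C1_on S (\<lambda>x. c)"
proof -
  have "partial i (\<lambda>x. c) = (\<lambda>_. 0)" for i :: 'a
    by (simp add: partial_const fun_eq_iff)
  then show ?thesis by (simp add: C1_on_def)
qed

lemma C1_on_component: "C1_on S (\<lambda>x. x $ j)"
proof -
  have "partial i (\<lambda>x. x $ j) = (\<lambda>_. if i = j then 1 else 0)" for i :: 'a
    by (simp only: partial_component fun_eq_iff simp_thms)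
  moreover have "(\<lambda>x::real^'a. x $ j) differentiable at x" for x
    by (intro bounded_linear_imp_differentiable bounded_linear_vec_nth)
  ultimately show ?thesis by (simp add: C1_on_def)
qed

lemma C1_on_add: "C1_on S f \<Longrightarrow> C1_on S g \<Longrightarrow> C1_on S (\<lambda>x. f x + g x)"
  and C1_on_diff: "C1_on S f \<Longrightarrow> C1_on S g \<Longrightarrow> C1_on S (\<lambda>x. f x - g x)"
  and C1_on_mult: "C1_on S f \<Longrightarrow> C1_on S g \<Longrightarrow> C1_on S (\<lambda>x. f x * g x)"
proof -
  assume f: "C1_on S f" and g: "C1_on S g"
  note fg = C1_onD[OF f] C1_onD[OF g]
  note cont = C1_on_partial[OF f] C1_on_partial[OF g] C1_on_continuous[OF f] C1_on_continuous[OF g]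
  have "continuous_on S (partial i (\<lambda>x. f x + g x))" for i
    by (rule continuous_on_eq[where f="\<lambda>x. partial i f x + partial i g x"])
      (auto intro!: continuous_intros cont simp: partial_add fg)
  then show "C1_on S (\<lambda>x. f x + g x)" using fg by (auto simp: C1_on_def)
  have "continuous_on S (partial i (\<lambda>x. f x - g x))" for i
    by (rule continuous_on_eq[where f="\<lambda>x. partial i f x - partial i g x"])
      (auto intro!: continuous_intros cont simp: partial_diff fg)
  then show "C1_on S (\<lambda>x. f x - g x)" using fg by (auto simp: C1_on_def)
  have "continuous_on S (partial i (\<lambda>x. f x * g x))" for i
    by (rule continuous_on_eq[where f="\<lambda>x. f x * partial i g x + partial i f x * g x"])
      (auto intro!: continuous_intros cont simp: partial_mult fg)
  then show "C1_on S (\<lambda>x. f x * g x)" using fg by (auto simp: C1_on_def)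
qed

lemma C1_on_sum: "(\<And>j. j \<in> A \<Longrightarrow> C1_on S (f j)) \<Longrightarrow> C1_on S (\<lambda>x. \<Sum>j\<in>A. f j x)"
  by (induction A rule: infinite_finite_induct) (auto intro: C1_on_const C1_on_add)

section \<open>Functions of the distance to the pole\<close>

lemma
  assumes u: "(u has_real_derivative u') (at (norm x))" and x: "x \<noteq> 0"
  shows has_derivative_radial:
      "((\<lambda>x. u (norm x)) has_derivative (\<lambda>v. u' * (v \<bullet> x / norm x))) (at x)"
    and partial_radial: "partial i (\<lambda>x. u (norm x)) x = u' * (x $ i / norm x)"
proof -
  have "((\<lambda>x. u (norm x)) has_derivative (\<lambda>v. (v \<bullet> sgn x) * u')) (at x)"
    using has_derivative_compose[OF has_derivative_norm[OF x] u[unfolded has_field_derivative_def]]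
    by (simp add: mult.commute)
  then show D: "((\<lambda>x. u (norm x)) has_derivative (\<lambda>v. u' * (v \<bullet> x / norm x))) (at x)"
    by (simp add: sgn_div_norm divide_simps mult.commute)
  show "partial i (\<lambda>x. u (norm x)) x = u' * (x $ i / norm x)"
    by (simp add: partial_eqI[OF D] inner_axis' )
qed

lemma C1_on_radial:
  assumes "\<And>t. t > 0 \<Longrightarrow> (u has_real_derivative u' t) (at t)" "continuous_on {0<..} u'"
  shows "C1_on (-{0}) (\<lambda>x::real^'n. u (norm x))"
  unfolding C1_on_def
proof (intro conjI ballI allI)
  fix x :: "real^'n" assume "x \<in> -{0}"
  then have "x \<noteq> 0" "norm x > 0" by auto
  then show "(\<lambda>x. u (norm x)) differentiable (at x)"
    using has_derivative_radial[OF assms(1)] differentiableI by blast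
next
  fix i :: 'n
  have "continuous_on (-{0}) (\<lambda>x::real^'n. u' (norm x))"
    by (rule continuous_on_compose2[OF assms(2)]) (auto intro!: continuous_intros)
  note cont = this
  show "continuous_on (-{0}) (partial i (\<lambda>x::real^'n. u (norm x)))"
    by (rule continuous_on_eq[where f="\<lambda>x. u' (norm x) * (x $ i / norm x)" and g="partial i (\<lambda>x. u (norm x))"])
      (auto intro!: continuous_intros cont simp: partial_radial[OF assms(1)])
qed

text \<open>Passage from the punctured space, where polar expressions are C^1, to the whole space:
  \<open>-{0}\<close> and \<open>ball 0 e\<close> are open and cover it.\<close>

lemma C1_on_UNIV_if_vanishing:
  fixes f :: "real^'n \<Rightarrow> real"
  assumes f: "C1_on (-{0}) f" and "\<And>x. norm x < e \<Longrightarrow> f x = 0" "e > 0"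
  shows "C1_on UNIV f"
proof -
  have g: "C1_on (ball 0 e) f"
  proof (rule C1_on_cong)
    show "C1_on (ball 0 e) (\<lambda>x::real^'n. 0)" by (rule C1_on_const)
  qed (use assms in auto)
  have U: "(-{0}) \<union> ball (0::real^'n) e = UNIV" using assms(3) by auto
  have "continuous_on (-{0} \<union> ball 0 e) (partial i f)" for i
    by (rule continuous_on_open_Un) (use C1_on_partial[OF f] C1_on_partial[OF g] in auto)
  moreover have "f differentiable (at x)" for x
    using C1_onD[OF f, of x] C1_onD[OF g, of x] U by blast
  ultimately show ?thesis unfolding C1_on_def U by blast
qed

text \<open>
  By translation invariance the difference quotients of \<open>Z\<close> have integral \<open>0\<close>, so Fubini is not needed.
\<close>

lemma integral_partial_eq_0:
  fixes Z :: "real^'n \<Rightarrow> real"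
  assumes Z: "C1_on UNIV Z" and supp: "\<And>x. norm x > R \<Longrightarrow> Z x = 0"
  shows "has_bochner_integral lborel (partial i Z) 0"
proof -
  let ?D = "partial i Z" and ?e = "axis i 1 :: real^'n"
  have contZ: "continuous_on UNIV Z" and contD: "continuous_on UNIV ?D"
    using C1_on_continuous[OF Z] C1_on_partial[OF Z] by blast+
  have suppD: "?D x = 0" if "norm x > R" for x
  proof -
    have "?D x = partial i (\<lambda>x. 0) x"
      by (rule partial_cong_open[of "- cball 0 R"]) (use that supp in auto)
    then show ?thesis by (simp add: partial_const)
  qed
  have int: "integrable lborel f" if "continuous_on UNIV f" "\<And>x. norm x > R \<Longrightarrow> f x = 0"
    for f :: "real^'n \<Rightarrow> real"
  proof -
    have "integrable lborel (\<lambda>x. indicator (cball 0 R) x *\<^sub>R f x)"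
      by (rule borel_integrable_compact) (auto intro: continuous_on_subset that)
    moreover have "(\<lambda>x. indicator (cball 0 R) x *\<^sub>R f x) = f"
      using that(2) by (force simp: indicator_def)
    ultimately show ?thesis by simp
  qed
  obtain B where B: "\<And>x. \<bar>?D x\<bar> \<le> B" "B \<ge> 0"
  proof -
    have "compact (?D ` cball 0 R)"
      by (intro compact_continuous_image continuous_on_subset[OF contD]) auto
    then obtain B where "\<forall>y\<in>?D ` cball 0 R. norm y \<le> B"
      using compact_imp_bounded bounded_iff by metis
    \<comment> \<open>If \<open>R < 0\<close>, the ball is empty and \<open>B\<close> may be
      negative, hence the maximum with 0.\<close>
    then have "\<bar>?D x\<bar> \<le> max B 0" for x
      using suppD[of x] by (cases "norm x > R") (auto simp: le_max_iff_disj)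
    then show ?thesis using that[of "max B 0"] by auto
  qed
  have line: "((\<lambda>t. Z (x + t *\<^sub>R ?e)) has_real_derivative ?D (x + t *\<^sub>R ?e)) (at t)" for x t
  proof -
    have "(Z has_derivative (\<lambda>v. \<Sum>j\<in>UNIV. v $ j * partial j Z (x + t *\<^sub>R ?e))) (at (x + t *\<^sub>R ?e))"
      using has_derivative_partial[OF C1_onD[OF Z UNIV_I]] .
    moreover have "((\<lambda>t. x + t *\<^sub>R ?e) has_derivative (\<lambda>t. t *\<^sub>R ?e)) (at t)"
      by (auto intro!: derivative_eq_intros)
    ultimately have "((\<lambda>t. Z (x + t *\<^sub>R ?e)) has_derivative
      (\<lambda>s. \<Sum>j\<in>UNIV. (s *\<^sub>R ?e) $ j * partial j Z (x + t *\<^sub>R ?e))) (at t)"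
      using has_derivative_compose by blast
    moreover have "(\<Sum>j\<in>UNIV. (s *\<^sub>R ?e) $ j * partial j Z (x + t *\<^sub>R ?e)) = ?D (x + t *\<^sub>R ?e) * s" for s
      by (simp add: axis_def if_distrib if_distribR sum.delta cong: if_cong)
    ultimately show ?thesis by (simp add: has_field_derivative_def)
  qed
  \<comment> \<open>Shifts of length at most 1 keep all difference quotients supported in
    \<open>cball 0 (R + 1)\<close>, which yields a common integrable majorant.\<close>
  define h where "h k = inverse (real (Suc k))" for k
  have h: "h k > 0" "h k \<le> 1" for k by (auto simp: h_def field_simps)
  have hlim: "h \<longlonglongrightarrow> 0" unfolding h_def by (rule LIMSEQ_inverse_real_of_nat)
  define q where "q k x = (Z (h k *\<^sub>R ?e + x) - Z x) / h k" for k x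
  have intZ: "integrable lborel Z" by (rule int[OF contZ supp])
  have shift: "integrable lborel (\<lambda>x. Z (c + x)) \<and> (\<integral>x. Z (c + x) \<partial>lborel) = (\<integral>x. Z x \<partial>lborel)" for c
  proof -
    have m: "(+) c \<in> measurable lborel borel" "Z \<in> borel_measurable borel"
      using contZ by (auto intro: borel_measurable_continuous_onI)
    have "integrable (distr lborel borel ((+) c)) Z" by (simp add: lborel_distr_plus intZ)
    then have "integrable lborel (\<lambda>x. Z (c + x))" using m by (simp add: integrable_distr_eq)
    moreover have "(\<integral>x. Z x \<partial>distr lborel borel ((+) c)) = (\<integral>x. Z (c + x) \<partial>lborel)"
      using m by (rule integral_distr)
    ultimately show ?thesis by (simp add: lborel_distr_plus)
  qed
  have q0: "(\<integral>x. q k x \<partial>lborel) = 0" for k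
    using shift[of "h k *\<^sub>R ?e"] intZ by (simp add: q_def)
  have qlim: "(\<lambda>k. q k x) \<longlonglongrightarrow> ?D x" for x
  proof -
    have "((\<lambda>s. (Z (x + s *\<^sub>R ?e) - Z x) / s) \<longlongrightarrow> ?D x) (at 0)"
      using line[of x 0] by (simp add: has_field_derivative_iff)
    then have "filterlim h (at 0) sequentially \<Longrightarrow> (\<lambda>k. (Z (x + h k *\<^sub>R ?e) - Z x) / h k) \<longlonglongrightarrow> ?D x"
      by (rule filterlim_compose)
    moreover have "filterlim h (at 0) sequentially"
      using hlim h(1) by (auto simp: filterlim_at intro!: always_eventually less_imp_neq[THEN not_sym])
    ultimately show ?thesis by (simp add: q_def add.commute)
  qed
  have qbd: "\<bar>q k x\<bar> \<le> B * indicator (cball 0 (R + 1)) x" for k x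
  proof (cases "norm x \<le> R + 1")
    case True
    \<comment> \<open>By the mean value theorem along the coordinate line the quotient is a value of
      the partial derivative, hence bounded by \<open>B\<close> uniformly in
      \<open>k\<close>.\<close>
    obtain z where "Z (x + h k *\<^sub>R ?e) - Z (x + 0 *\<^sub>R ?e) = (h k - 0) * ?D (x + z *\<^sub>R ?e)"
      using MVT2[of 0 "h k" "\<lambda>t. Z (x + t *\<^sub>R ?e)" "\<lambda>t. ?D (x + t *\<^sub>R ?e)"] line h by blast
    then have "q k x = ?D (x + z *\<^sub>R ?e)" using h(1)[of k] by (simp add: q_def add.commute)
    then show ?thesis using B True by (simp add: indicator_def)
  next
    case False
    have "norm x \<le> norm (h k *\<^sub>R ?e + x) + norm (h k *\<^sub>R ?e)"
      using norm_triangle_ineq4[of "h k *\<^sub>R ?e + x" "h k *\<^sub>R ?e"] by simp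
    then have "norm (h k *\<^sub>R ?e + x) > R" using False h[of k] by (simp add: norm_axis_1)
    then show ?thesis using False supp by (simp add: q_def)
  qed
  have mq: "q k \<in> borel_measurable lborel" for k
    unfolding q_def by (intro borel_measurable_divide borel_measurable_diff)
      (use shift intZ in \<open>auto dest: borel_measurable_integrable\<close>)
  have ind: "integrable lborel (\<lambda>x. B * indicator (cball 0 (R + 1)) (x::real^'n))"
    by (intro integrable_mult_right integrable_real_indicator)
      (use emeasure_bounded_finite[OF bounded_cball] in auto)
  have mD: "?D \<in> borel_measurable lborel"
    using borel_measurable_continuous_onI[OF contD] by simp
  have "(\<lambda>k. \<integral>x. q k x \<partial>lborel) \<longlonglongrightarrow> (\<integral>x. ?D x \<partial>lborel)"
    by (rule integral_dominated_convergence[OF mD mq ind])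
      (simp_all add: qlim qbd)
  then have "(\<lambda>k::nat. 0::real) \<longlonglongrightarrow> (\<integral>x. ?D x \<partial>lborel)" by (simp only: q0)
  then have "(\<integral>x. ?D x \<partial>lborel) = 0" using LIMSEQ_unique[OF tendsto_const] by metis
  moreover have "integrable lborel ?D" by (rule int[OF contD suppD])
  ultimately show ?thesis by (simp add: has_bochner_integral_iff)
qed

section \<open>The model metric in Cartesian coordinates\<close>

lemma frechet_derivative_norm_at:
  fixes x :: "'a::real_inner"
  assumes "x \<noteq> 0"
  shows "frechet_derivative norm (at x) v = (x \<bullet> v) / norm x"
proof -
  have "frechet_derivative norm (at x) = (\<lambda>v. v \<bullet> sgn x)"
    by (rule frechet_derivative_at[symmetric, OF has_derivative_norm[OF assms]])
  then show ?thesis by (simp add: sgn_div_norm inner_commute divide_inverse mult.commute)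
qed

lemma frechet_derivative_sgn_at:
  fixes x :: "'a::real_inner"
  assumes x: "x \<noteq> 0"
  shows "frechet_derivative sgn (at x) v = v /\<^sub>R norm x - ((x \<bullet> v) / norm x ^ 3) *\<^sub>R x"
proof -
  have "((\<lambda>x. inverse (norm x) *\<^sub>R x) has_derivative
      (\<lambda>v. inverse (norm x) *\<^sub>R v + (- (inverse (norm x) * (v \<bullet> sgn x) * inverse (norm x))) *\<^sub>R x)) (at x)"
    by (rule has_derivative_scaleR[OF Deriv.has_derivative_inverse[OF _ has_derivative_norm[OF x]] has_derivative_ident])
      (use x in simp)
  moreover have "(\<lambda>x::'a. inverse (norm x) *\<^sub>R x) = sgn"
    by (simp add: fun_eq_iff sgn_div_norm)
  ultimately have "(sgn has_derivative
      (\<lambda>v. inverse (norm x) *\<^sub>R v + (- (inverse (norm x) * (v \<bullet> sgn x) * inverse (norm x))) *\<^sub>R x)) (at x)"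
    by (simp only:)
  from frechet_derivative_at[OF this, symmetric] have "frechet_derivative sgn (at x) v =
      inverse (norm x) *\<^sub>R v + (- (inverse (norm x) * (v \<bullet> sgn x) * inverse (norm x))) *\<^sub>R x"
    by (rule fun_cong)
  moreover have "inverse (norm x) * (v \<bullet> sgn x) * inverse (norm x) = (x \<bullet> v) / norm x ^ 3"
    by (simp add: sgn_div_norm inner_commute[of v x] power3_eq_cube divide_inverse)
  ultimately show ?thesis by (simp only: scaleR_minus_left diff_conv_add_uminus)
qed

text \<open>The derivative of \<open>sgn\<close> kills the radial direction and divides orthogonal
  vectors by \<open>t = norm x\<close>. So the form splits into the Euclidean radial part and
  \<open>(r t / t)^2\<close> times the Euclidean tangential part.\<close>

lemma polar_metric_eq:
  fixes x :: "real^'n"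
  assumes x: "x \<noteq> 0"
  shows "polar_metric r x v w = (x \<bullet> v) * (x \<bullet> w) / (norm x)\<^sup>2 +
    (r (norm x) / norm x)\<^sup>2 * (v \<bullet> w - (x \<bullet> v) * (x \<bullet> w) / (norm x)\<^sup>2)"
proof -
  define t where "t = norm x"
  have t: "t \<noteq> 0" "x \<bullet> x = t\<^sup>2" using x by (auto simp: t_def power2_norm_eq_inner)
  have "frechet_derivative sgn (at x) v \<bullet> frechet_derivative sgn (at x) w
    = (v \<bullet> w - (x \<bullet> v) * (x \<bullet> w) / t\<^sup>2) / t\<^sup>2"
    unfolding frechet_derivative_sgn_at[OF x] t_def[symmetric] using t
    by (simp add: inner_diff_left inner_diff_right inner_commute[of v x] inner_commute[of w x])
      (simp add: field_simps power2_eq_square power3_eq_cube)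
  then show ?thesis
    unfolding polar_metric_def frechet_derivative_norm_at[OF x] t_def[symmetric] using t
    by (simp add: power_divide power2_eq_square)
qed

section \<open>The metric matrix, its inverse and its density\<close>

context
  fixes r :: "real \<Rightarrow> real" and G :: "real^'n \<Rightarrow> real^'n^'n" and x :: "real^'n"
  assumes M: "model_manifold r G" and x: "x \<noteq> 0"
begin

text \<open>Testing against all \<open>v\<close> turns the bilinear form into the matrix:
  \<open>G x\<close> is the identity on the line through \<open>x\<close> and multiplication by
  \<open>(r t / t)^2\<close>, with \<open>t = norm x\<close>, on the orthogonal complement.\<close>

lemma model_metric_mult:
  "G x *v w = (x \<bullet> w / (norm x)\<^sup>2) *\<^sub>R x +
    (r (norm x) / norm x)\<^sup>2 *\<^sub>R (w - (x \<bullet> w / (norm x)\<^sup>2) *\<^sub>R x)"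
proof -
  have "v \<bullet> (G x *v w) = v \<bullet> ((x \<bullet> w / (norm x)\<^sup>2) *\<^sub>R x +
    (r (norm x) / norm x)\<^sup>2 *\<^sub>R (w - (x \<bullet> w / (norm x)\<^sup>2) *\<^sub>R x))" for v
  proof -
    have "\<forall>x v w. x \<noteq> 0 \<longrightarrow> v \<bullet> (G x *v w) = polar_metric r x v w"
      using M unfolding model_manifold_def by (elim conjE)
    from this[rule_format, OF x, of v w]
    show ?thesis
      unfolding polar_metric_eq[OF x] inner_add_right inner_diff_right inner_scaleR_right inner_commute[of v x]
      by (simp only: times_divide_eq_left mult.commute[of "x \<bullet> v"])
  qed
  then show ?thesis by (subst vector_eq_ldot[symmetric]) (rule allI)
qed

text \<open>The eigenvalues of \<open>G x\<close> are inverted: \<open>G x\<close> maps the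
  right-hand side to \<open>w\<close>, and positive definiteness makes \<open>G x\<close>
  invertible, so that \<open>matrix_inv\<close> is a true inverse.\<close>

lemma model_metric_inverse_mult:
  "matrix_inv (G x) *v w = (x \<bullet> w / (norm x)\<^sup>2) *\<^sub>R x +
    (norm x / r (norm x))\<^sup>2 *\<^sub>R (w - (x \<bullet> w / (norm x)\<^sup>2) *\<^sub>R x)" (is "_ = ?B")
proof -
  have t: "norm x \<noteq> 0" "x \<bullet> x = (norm x)\<^sup>2"
    using x by (simp_all add: dot_square_norm)
  have "\<forall>t>0. r t > 0" using M unfolding model_manifold_def by (elim conjE)
  then have "r (norm x) > 0" using x by (simp only: zero_less_norm_iff simp_thms)
  then have r: "r (norm x) \<noteq> 0" by simp
  have xB: "x \<bullet> ?B = x \<bullet> w"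
    unfolding inner_add_right inner_diff_right inner_scaleR_right t(2) using t(1) by simp
  have "(r (norm x) / norm x)\<^sup>2 * (norm x / r (norm x))\<^sup>2 = 1"
    using t(1) r by (simp add: power_divide)
  then have "G x *v ?B = w"
    unfolding model_metric_mult xB by (simp only: add_diff_cancel_left' scaleR_scaleR scaleR_one) simp
  moreover have inj: "inj ((*v) (G x))"
  proof (rule injI)
    fix a b assume "G x *v a = G x *v b"
    then have "(a - b) \<bullet> (G x *v (a - b)) = 0"
      by (simp add: matrix_vector_mult_diff_distrib)
    moreover have "\<forall>x v. v \<noteq> 0 \<longrightarrow> v \<bullet> (G x *v v) > 0"
      using M unfolding model_manifold_def riemannian_metric_def by (elim conjE)
    ultimately have "a - b = 0" by (metis order_less_irrefl)
    then show "a = b" by simp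
  qed
  have "matrix_inv (G x) ** G x = mat 1"
  proof -
    have "invertible (G x)"
      using inj by (simp add: invertible_left_inverse matrix_left_invertible_injective)
    then show ?thesis unfolding invertible_def matrix_inv_def by (rule someI2_ex) simp
  qed
  ultimately show ?thesis
    by (metis matrix_vector_mul_assoc matrix_vector_mul_lid)
qed

text \<open>In an orthonormal basis containing \<open>sgn x\<close> the metric is diagonal, with one
  entry 1 and \<open>n - 1\<close> entries \<open>s^2\<close> for \<open>s = r t / t\<close>. An
  orthogonal change of basis does not alter the determinant.\<close>

lemma sqrt_det_model_metric:
  "sqrt (det (G x)) = (r (norm x) / norm x) ^ (CARD('n) - 1)"
proof -
  define t where "t = norm x"
  define s where "s = r t / t"
  have t: "t > 0" using x by (simp add: t_def)
  have "\<forall>t>0. r t > 0" using M unfolding model_manifold_def by (elim conjE)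
  then have s: "s > 0" using t by (simp add: s_def)
  fix k :: 'n
  obtain A where A: "orthogonal_matrix A" "A *v axis k 1 = sgn x"
    using orthogonal_matrix_exists_basis[of "sgn x" k] x by (auto simp: norm_sgn)
  have xA: "x = t *\<^sub>R (A *v axis k 1)" using x by (simp add: A(2) sgn_div_norm t_def)
  have adj: "v \<bullet> (transpose A *v w) = (A *v v) \<bullet> w" for v w
    by (simp only: transpose_matrix_vector inner_commute[of v] dot_lmul_matrix inner_commute[of _ w])
  have orth: "(A *v v) \<bullet> (A *v w) = v \<bullet> w" for v w
    using A(1) by (simp add: adj[symmetric] matrix_vector_mul_assoc orthogonal_matrix)
  define D :: "real^'n^'n" where "D = (\<chi> i j. if i = j then (if i = k then 1 else s\<^sup>2) else 0)"
  have "transpose A ** G x ** A = D"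
  proof -
    have "(transpose A ** G x ** A) $ i $ j = D $ i $ j" for i j
    proof -
      have "(transpose A ** G x ** A) $ i $ j = axis i 1 \<bullet> ((transpose A ** G x ** A) *v axis j 1)"
        by (simp add: inner_axis' matrix_vector_mult_basis column_def)
      also have "\<dots> = (A *v axis i 1) \<bullet> (G x *v (A *v axis j 1))"
        by (simp only: matrix_vector_mul_assoc[symmetric] adj)
      also have "\<dots> = (if i = k \<and> j = k then 1 else 0) +
          s\<^sup>2 * ((if i = j then 1 else 0) - (if i = k \<and> j = k then 1 else 0))"
        unfolding model_metric_mult t_def[symmetric] s_def[symmetric]
        using t by (simp add: xA inner_add_right inner_diff_right orth inner_axis_axis power2_eq_square)
      also have "\<dots> = D $ i $ j" by (auto simp: D_def)
      finally show ?thesis .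
    qed
    then show ?thesis by (simp add: vec_eq_iff)
  qed
  moreover have "det (transpose A ** G x ** A) = det (G x)"
  proof -
    have "det A * det A = 1"
      using det_orthogonal_matrix[OF A(1)] by auto
    then show ?thesis by (simp add: det_mul det_transpose mult.commute mult.left_commute)
  qed
  moreover have "det D = (\<Prod>i\<in>UNIV. D $ i $ i)"
    by (rule det_diagonal) (simp add: D_def)
  moreover have "(\<Prod>i\<in>UNIV. D $ i $ i) = (\<Prod>i\<in>UNIV - {k}. s\<^sup>2)"
    by (subst prod.remove[of _ k]) (auto simp: D_def intro!: prod.cong)
  ultimately have "det (G x) = (s ^ (CARD('n) - 1))\<^sup>2"
    by (simp add: card_Diff_singleton power_mult[symmetric] mult.commute)
  then show ?thesis using s by (simp add: s_def t_def)
qed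

end

section \<open>Integration in polar coordinates\<close>

text \<open>Both measures give \<open>{..a}\<close> the volume of the ball of radius
  \<open>a\<close> (0 if \<open>a < 0\<close>), the right one because its density is the derivative
  of that volume. These half-lines form an intersection-stable generator of the Borel sets.\<close>

lemma distr_lborel_norm:
  "distr lborel borel (norm :: 'a::euclidean_space \<Rightarrow> real) =
    density lborel (\<lambda>t. ennreal (real DIM('a) * unit_ball_vol (real DIM('a)) * t ^ (DIM('a) - 1)) * indicator {0..} t)"
    (is "?M = density lborel (\<lambda>t. ennreal (?c * t ^ ?m) * indicator {0..} t)")
proof (rule measure_eqI_generator_eq[where E="range atMost" and \<Omega>=UNIV and A="\<lambda>i. {..real i}"])
  let ?N = "density lborel (\<lambda>t. ennreal (?c * t ^ ?m) * indicator {0..} t)"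
  have D: "DIM('a) > 0" by simp
  have M: "emeasure ?M {..a} = (if a < 0 then 0 else ennreal (unit_ball_vol DIM('a) * a ^ DIM('a)))" for a
  proof -
    have "emeasure ?M {..a} = emeasure lborel (norm -` {..a} :: 'a set)"
      by (subst emeasure_distr) simp_all
    also have "norm -` {..a} = (if a < 0 then {} else cball (0::'a) a)"
    proof (cases "a < 0")
      case True
      then have "\<not> norm x \<le> a" for x :: 'a using norm_ge_zero[of x] by linarith
      then show ?thesis using True by (simp add: vimage_def)
    qed (simp add: vimage_def cball_def)
    also have "emeasure lborel \<dots> = (if a < 0 then 0 else ennreal (unit_ball_vol DIM('a) * a ^ DIM('a)))"
      by (simp add: emeasure_cball)
    finally show ?thesis .
  qed
  have N: "emeasure ?N {..a} = (if a < 0 then 0 else ennreal (unit_ball_vol DIM('a) * a ^ DIM('a)))" for a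
  proof (cases "a < 0")
    case True
    have "emeasure ?N {..a} = (\<integral>\<^sup>+t. ennreal (?c * t ^ ?m) * indicator {0..} t * indicator {..a} t \<partial>lborel)"
      by (rule emeasure_density) simp_all
    also have "\<dots> = (\<integral>\<^sup>+t. 0 \<partial>(lborel::real measure))"
      by (rule nn_integral_cong) (use True in \<open>auto simp: indicator_def\<close>)
    finally show ?thesis using True by simp
  next
    case False
    have "emeasure ?N {..a} = (\<integral>\<^sup>+t. ennreal (?c * t ^ ?m) * indicator {0..} t * indicator {..a} t \<partial>lborel)"
      by (rule emeasure_density) simp_all
    also have "\<dots> = (\<integral>\<^sup>+t. ennreal (?c * t ^ ?m) * indicator {0..a} t \<partial>lborel)"
      by (rule nn_integral_cong) (auto simp: indicator_def)
    also have "\<dots> = ennreal (unit_ball_vol DIM('a) * a ^ DIM('a) - unit_ball_vol DIM('a) * 0 ^ DIM('a))"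
    proof (rule nn_integral_FTC_Icc)
      show "((\<lambda>t. unit_ball_vol DIM('a) * t ^ DIM('a)) has_real_derivative ?c * x ^ ?m) (at x)" for x
        by (auto intro!: derivative_eq_intros)
      show "0 \<le> ?c * x ^ ?m" if "x \<in> {0..a}" for x
        using that by simp
    qed (use False in simp_all)
    finally show ?thesis using False by (simp add: power_0_left)
  qed
  show "Int_stable (range (atMost :: real \<Rightarrow> _))" by (auto simp: Int_stable_def)
  show "emeasure ?M X = emeasure ?N X" if "X \<in> range atMost" for X
    using that by (elim imageE) (simp only: M N)
  show "sets ?M = sigma_sets UNIV (range atMost)" "sets ?N = sigma_sets UNIV (range atMost)"
    unfolding sets_distr sets_density sets_lborel by (simp_all add: borel_eq_atMost)
  show "(\<Union>i. {..real i}) = UNIV"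
    by (rule UNIV_eq_I[symmetric]) (simp add: real_arch_simple)
  show "emeasure ?M {..real i} \<noteq> \<infinity>" for i
    by (simp add: M)
qed auto

lemma integral_radial:
  fixes F :: "real \<Rightarrow> real"
  assumes F[measurable]: "F \<in> borel_measurable borel"
  shows "(\<integral>x. F (norm x) \<partial>(lborel :: 'a::euclidean_space measure)) =
    real DIM('a) * unit_ball_vol (real DIM('a)) * (\<integral>t. indicator {0..} t * (t ^ (DIM('a) - 1) * F t) \<partial>lborel)"
proof -
  let ?c = "real DIM('a) * unit_ball_vol (real DIM('a))"
  have "(\<integral>x. F (norm x) \<partial>(lborel :: 'a measure)) = (\<integral>t. F t \<partial>distr lborel borel (norm :: 'a \<Rightarrow> real))"
    by (rule integral_distr[symmetric]) simp_all
  also have "\<dots> = (\<integral>t. F t \<partial>density lborel (\<lambda>t. ennreal (?c * t ^ (DIM('a) - 1) * indicator {0..} t)))"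
    unfolding distr_lborel_norm by (simp add: ennreal_mult'' ennreal_indicator)
  also have "\<dots> = (\<integral>t. (?c * t ^ (DIM('a) - 1) * indicator {0..} t) *\<^sub>R F t \<partial>lborel)"
  proof (rule integral_density)
    show "AE t in lborel. 0 \<le> ?c * t ^ (DIM('a) - 1) * indicator {0..} t"
      by (rule AE_I2) (auto simp: indicator_def)
  qed simp_all
  also have "\<dots> = (\<integral>t. ?c * (indicator {0..} t * (t ^ (DIM('a) - 1) * F t)) \<partial>lborel)"
    by (rule Bochner_Integration.integral_cong) (simp_all add: mult_ac)
  finally show ?thesis by simp
qed

section \<open>Smooth coefficients and the Riemannian measure\<close>

lemma smooth_imp_continuous: "smooth f \<Longrightarrow> continuous_on UNIV f"
  by (metis C_k.simps(1) smooth_def)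

lemma smooth_imp_C1_on: "smooth f \<Longrightarrow> C1_on S f"
proof -
  assume "smooth f"
  then have "C_k (Suc 0) f" by (simp only: smooth_def)
  then show "C1_on S f" unfolding C1_on_def by (auto intro: continuous_on_subset)
qed

lemma smooth_partial: "smooth f \<Longrightarrow> smooth (partial i f)"
  unfolding smooth_def by (metis C_k.simps(2))

lemma continuous_sqrt_det:
  assumes "riemannian_metric G"
  shows "continuous_on S (\<lambda>x. sqrt (det (G x)))"
proof -
  have "continuous_on UNIV (\<lambda>x. G x $ i $ j)" for i j
    using assms smooth_imp_continuous by (auto simp: riemannian_metric_def)
  then have c: "continuous_on S (\<lambda>x. G x $ i $ j)" for i j
    using continuous_on_subset by blast
  show ?thesis unfolding det_def
    by (intro continuous_on_real_sqrt continuous_on_sum continuous_on_mult continuous_on_const continuous_on_prod c)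
qed

lemma smooth_on_halfline_continuous:
  assumes "smooth_on_halfline r"
  shows "continuous_on {0..} r"
proof -
  obtain D where "D 0 = r" "\<And>t. t \<ge> 0 \<Longrightarrow> (D 0 has_real_derivative D (Suc 0) t) (at t within {0..})"
    using assms unfolding smooth_on_halfline_def by blast
  then show ?thesis
    by (intro DERIV_continuous_on[of _ r "D 1"]) auto
qed

lemma integral_volume_measure:
  fixes f :: "real^'n \<Rightarrow> 'b::{banach, second_countable_topology}"
  assumes M: "model_manifold r G" and f: "f \<in> borel_measurable borel"
  shows "(\<integral>x. f x \<partial>volume_measure G) = (\<integral>x. sqrt (det (G x)) *\<^sub>R f x \<partial>lborel)"
    and "integrable (volume_measure G) f \<longleftrightarrow> integrable lborel (\<lambda>x. sqrt (det (G x)) *\<^sub>R f x)"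
proof -
  have G: "riemannian_metric G" using M unfolding model_manifold_def by (elim conjE)
  have pos: "\<forall>t>0. r t > 0" using M unfolding model_manifold_def by (elim conjE)
  have "(\<lambda>x. sqrt (det (G x))) \<in> borel_measurable borel"
    by (rule borel_measurable_continuous_onI) (rule continuous_sqrt_det[OF G])
  then have m: "(\<lambda>x. sqrt (det (G x))) \<in> borel_measurable lborel" by simp
  have "0 \<le> sqrt (det (G x))" if "x \<noteq> 0" for x
  proof -
    have "r (norm x) > 0" using pos that by (simp only: zero_less_norm_iff simp_thms)
    then show ?thesis unfolding sqrt_det_model_metric[OF M that] by (intro zero_le_power) simp
  qed
  \<comment> \<open>The formula for the density is available only off the pole, which is a null
    set.\<close>
  then have nn: "AE x in lborel. 0 \<le> sqrt (det (G x))"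
    using AE_lborel_singleton[of 0] by (auto elim: eventually_mono)
  have f': "f \<in> borel_measurable lborel" using f by simp
  show "(\<integral>x. f x \<partial>volume_measure G) = (\<integral>x. sqrt (det (G x)) *\<^sub>R f x \<partial>lborel)"
    unfolding volume_measure_def by (rule integral_density[OF f' m nn])
  show "integrable (volume_measure G) f \<longleftrightarrow> integrable lborel (\<lambda>x. sqrt (det (G x)) *\<^sub>R f x)"
    unfolding volume_measure_def by (rule integrable_density[OF f' m nn])
qed

text \<open>The density \<open>(r t / t)^(n - 1)\<close> cancels the Euclidean factor
  \<open>t^(n - 1)\<close> and leaves the weight \<open>r^(n - 1)\<close>.\<close>

lemma integral_volume_measure_radial:
  fixes F :: "real \<Rightarrow> real" and G :: "real^'n \<Rightarrow> real^'n^'n"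
  assumes M: "model_manifold r G" and F: "F \<in> borel_measurable borel"
  shows "(\<integral>x. F (norm x) \<partial>volume_measure G) =
    real CARD('n) * unit_ball_vol (real CARD('n)) *
      (\<integral>t. indicator {0<..} t * (r t ^ (CARD('n) - 1) * F t) \<partial>lborel)"
proof -
  \<comment> \<open>\<open>H\<close> absorbs the density into the radial integrand. The value 0 for
    \<open>t \<le> 0\<close> makes it measurable, as nothing is known of \<open>r\<close> on the
    negative axis.\<close>
  define H where "H t = (if t > 0 then (r t / t) ^ (CARD('n) - 1) * F t else 0)" for t
  have "continuous_on {0..} r"
    using M smooth_on_halfline_continuous by (auto simp: model_manifold_def)
  then have "continuous_on {0<..} r" by (rule continuous_on_subset) auto
  then have "(\<lambda>t. indicator {0<..} t *\<^sub>R (r t / t) ^ (CARD('n) - 1)) \<in> borel_measurable borel"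
    by (intro borel_measurable_continuous_on_indicator) (auto intro!: continuous_intros)
  then have "(\<lambda>t. indicator {0<..} t *\<^sub>R (r t / t) ^ (CARD('n) - 1) * F t) \<in> borel_measurable borel"
    using F by (rule borel_measurable_times)
  also have "(\<lambda>t. indicator {0<..} t *\<^sub>R (r t / t) ^ (CARD('n) - 1) * F t) = H"
    by (auto simp: H_def fun_eq_iff)
  finally have H: "H \<in> borel_measurable borel" .
  have mF: "(\<lambda>x::real^'n. F (norm x)) \<in> borel_measurable borel" "(\<lambda>x::real^'n. H (norm x)) \<in> borel_measurable borel"
    using F H by simp_all
  have "riemannian_metric G" using M by (auto simp: model_manifold_def)
  from borel_measurable_continuous_onI[OF continuous_sqrt_det[OF this]]
  have mG: "(\<lambda>x. sqrt (det (G x))) \<in> borel_measurable borel" .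
  have "(\<integral>x. F (norm x) \<partial>volume_measure G) = (\<integral>x. sqrt (det (G x)) * F (norm x) \<partial>lborel)"
    using integral_volume_measure(1)[OF M mF(1)] by simp
  also have "\<dots> = (\<integral>x. H (norm x) \<partial>(lborel :: (real^'n) measure))"
  proof (rule Bochner_Integration.integral_cong_AE)
    show "AE x in lborel. sqrt (det (G x)) * F (norm x) = H (norm x)"
      using AE_lborel_singleton[of 0]
      by eventually_elim (simp add: H_def sqrt_det_model_metric[OF M])
  qed (use mF mG in simp_all)
  also have "\<dots> = real CARD('n) * unit_ball_vol (real CARD('n)) *
      (\<integral>t. indicator {0..} t * (t ^ (CARD('n) - 1) * H t) \<partial>lborel)"
    using integral_radial[OF H, where 'a="real^'n"] by simp
  also have "(\<integral>t. indicator {0..} t * (t ^ (CARD('n) - 1) * H t) \<partial>lborel) =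
      (\<integral>t. indicator {0<..} t * (r t ^ (CARD('n) - 1) * F t) \<partial>lborel)"
    by (rule Bochner_Integration.integral_cong) (auto simp: H_def indicator_def power_divide)
  finally show ?thesis .
qed

section \<open>The Laplacian of a radial function\<close>

lemma C1_on_power: "C1_on S f \<Longrightarrow> C1_on S (\<lambda>x. f x ^ m)"
  by (induction m) (auto intro: C1_on_const C1_on_mult)

text \<open>The annulus is compact and avoids the pole, so continuity on \<open>-{0}\<close> is
  enough.\<close>

lemma
  fixes f :: "real^'n \<Rightarrow> real"
  assumes f: "continuous_on (-{0}) f" and supp: "\<And>x. norm x \<notin> {a..b} \<Longrightarrow> f x = 0" and a: "0 < a"
  shows integrable_annulus: "integrable lborel f"
    and measurable_annulus: "f \<in> borel_measurable borel"
proof -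
  let ?A = "cball 0 b - ball (0::real^'n) a"
  have "integrable lborel (\<lambda>x. indicator ?A x *\<^sub>R f x)"
  proof (rule borel_integrable_compact)
    show "compact ?A" by (rule compact_diff) auto
    show "continuous_on ?A f" by (rule continuous_on_subset[OF f]) (use a in auto)
  qed
  moreover have "(\<lambda>x. indicator ?A x *\<^sub>R f x) = f"
    using supp by (auto simp: indicator_def fun_eq_iff)
  ultimately show "integrable lborel f" by simp
  then show "f \<in> borel_measurable borel" by (auto dest: borel_measurable_integrable)
qed

text \<open>Where \<open>r\<close> is positive, this is \<open>r^(-N) * d/dt (r^N * u')\<close>, the
  Laplacian of \<open>u (norm x)\<close> in dimension \<open>N + 1\<close>. The derivatives are
  passed as functions so that explicit formulas can be inserted.\<close>

definition radial_laplace :: "nat \<Rightarrow> (real \<Rightarrow> real) \<Rightarrow> (real \<Rightarrow> real) \<Rightarrow> (real \<Rightarrow> real) \<Rightarrow> (real \<Rightarrow> real) \<Rightarrow> real \<Rightarrow> real"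
  where "radial_laplace N r r' u' u'' t = u'' t + real N * (r' t / r t) * u' t"

section \<open>Green's identity for a radial function supported away from the pole\<close>

context
  fixes r r' u u' u'' :: "real \<Rightarrow> real" and G :: "real^'n \<Rightarrow> real^'n^'n" and a b :: real and N :: nat
  assumes M: "model_manifold r G" and card: "CARD('n) \<ge> 2" and N: "N = CARD('n) - 1"
    and r': "\<And>t. t > 0 \<Longrightarrow> (r has_real_derivative r' t) (at t)" "continuous_on {0<..} r'"
    and a: "a > 0"
    and u': "\<And>t. (u has_real_derivative u' t) (at t)"
    and u'': "\<And>t. (u' has_real_derivative u'' t) (at t)" "continuous_on UNIV u''"
    and supp: "\<And>t. t \<notin> {a..b} \<Longrightarrow> u t = 0 \<and> u' t = 0 \<and> u'' t = 0"
begin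

abbreviation radial_laplacian :: "real \<Rightarrow> real" where
  "radial_laplacian \<equiv> radial_laplace N r r' u' u''"

lemma r_pos: "t > 0 \<Longrightarrow> r t > 0"
proof -
  have "\<forall>t>0. r t > 0" using M unfolding model_manifold_def by (elim conjE)
  then show "t > 0 \<Longrightarrow> r t > 0" by simp
qed

lemma continuous_on_u: "continuous_on S u" "continuous_on S u'" "continuous_on S u''"
  "continuous_on {0<..} r"
proof -
  show "continuous_on S u" "continuous_on S u'"
    by (rule DERIV_continuous_on[OF has_field_derivative_at_within], rule u' u'')+
  show "continuous_on S u''" using u''(2) by (rule continuous_on_subset) simp
  show "continuous_on {0<..} r"
    by (rule DERIV_continuous_on[OF has_field_derivative_at_within], rule r') simp
qed

lemma continuous_on_radial_laplacian: "continuous_on {0<..} radial_laplacian"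
  unfolding radial_laplace_def
  by (intro continuous_intros continuous_on_u r') (use r_pos in force)

lemma C1_on_model:
  shows "C1_on (-{0}) (\<lambda>x::real^'n. r (norm x))"
    and "C1_on (-{0}) (\<lambda>x::real^'n. inverse (r (norm x)))"
    and "C1_on (-{0}) (\<lambda>x::real^'n. norm x)"
    and "C1_on (-{0}) (\<lambda>x::real^'n. inverse (norm x))"
    and "C1_on (-{0}) (\<lambda>x::real^'n. u (norm x))"
    and "C1_on (-{0}) (\<lambda>x::real^'n. u' (norm x))"
proof -
  show "C1_on (-{0}) (\<lambda>x::real^'n. r (norm x))"
    by (rule C1_on_radial[OF r'])
  have nz: "r t \<noteq> 0" if "t > 0" for t using r_pos[OF that] by simp
  have "((\<lambda>t. inverse (r t)) has_real_derivative - (inverse (r t) * r' t * inverse (r t))) (at t)"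
    if "t > 0" for t
    by (rule DERIV_inverse'[OF r'(1)[OF that] nz[OF that]])
  moreover have "continuous_on {0<..} (\<lambda>t. - (inverse (r t) * r' t * inverse (r t)))"
    by (intro continuous_intros continuous_on_u r') (use nz in auto)
  ultimately show "C1_on (-{0}) (\<lambda>x::real^'n. inverse (r (norm x)))"
    by (rule C1_on_radial)
  show "C1_on (-{0}) (\<lambda>x::real^'n. norm x)"
    by (rule C1_on_radial[where u="\<lambda>t. t" and u'="\<lambda>_. 1"]) (auto intro: derivative_eq_intros)
  have "(inverse has_real_derivative - (inverse t * 1 * inverse t)) (at t)" if "t > 0" for t :: real
    by (rule DERIV_inverse'[OF DERIV_ident]) (use that in simp)
  moreover have "continuous_on {0<..} (\<lambda>t::real. - (inverse t * 1 * inverse t))"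
    by (intro continuous_intros) auto
  ultimately show "C1_on (-{0}) (\<lambda>x::real^'n. inverse (norm x))"
    by (rule C1_on_radial)
  show "C1_on (-{0}) (\<lambda>x::real^'n. u (norm x))"
    by (rule C1_on_radial[OF u' continuous_on_u(2)])
  show "C1_on (-{0}) (\<lambda>x::real^'n. u' (norm x))"
    by (rule C1_on_radial[OF u''(1) continuous_on_u(3)])
qed

text \<open>The flat divergence of this field is the density times the Laplacian, which reduces the
  Riemannian divergence theorem to the Euclidean one.\<close>

definition gradient_field :: "(real^'n \<Rightarrow> real) \<Rightarrow> 'n \<Rightarrow> real^'n \<Rightarrow> real" where
  "gradient_field \<phi> i x = sqrt (det (G x)) * gradient G \<phi> x $ i"

text \<open>Closed form, off the pole, of the density times the gradient of
  \<open>u (norm x)\<close>: the metric is Euclidean in the radial direction, so this gradient is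
  \<open>u' t / t\<close> times \<open>x\<close>, with \<open>t = norm x\<close>.\<close>

definition radial_field :: "'n \<Rightarrow> real^'n \<Rightarrow> real" where
  "radial_field i x = (r (norm x) / norm x) ^ (CARD('n) - 1) * (u' (norm x) / norm x) * x $ i"

text \<open>The explicit inverse and density of the metric write the field off the pole as sums and
  products of C^1 functions, so neither \<open>matrix_inv\<close> nor \<open>det\<close> has to be
  differentiated.\<close>

lemma C1_on_gradient_field:
  assumes \<phi>: "smooth \<phi>"
  shows "C1_on (-{0}) (gradient_field \<phi> i)"
proof (rule C1_on_cong)
  let ?p = "\<lambda>x. \<Sum>j\<in>UNIV. x $ j * partial j \<phi> x"
  let ?q = "\<lambda>x. ?p x * (inverse (norm x) * inverse (norm x)) * x $ i"
  let ?f = "\<lambda>x. (r (norm x) * inverse (norm x)) ^ (CARD('n) - 1) *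
    (?q x + (norm x * inverse (r (norm x)))\<^sup>2 * (partial i \<phi> x - ?q x))"
  note C1 = C1_on_model smooth_imp_C1_on[OF smooth_partial[OF \<phi>]]
  show "C1_on (-{0}) ?f"
    by (intro C1_on_mult C1_on_add C1_on_diff C1_on_power C1_on_sum C1_on_component C1)
  fix x :: "real^'n" assume "x \<in> -{0}"
  then have x: "x \<noteq> 0" by simp
  show "?f x = gradient_field \<phi> i x"
    unfolding gradient_field_def gradient_def model_metric_inverse_mult[OF M x] sqrt_det_model_metric[OF M x]
    by (simp add: inner_vec_def divide_inverse power2_eq_square)
qed auto

lemma C1_on_radial_field: "C1_on (-{0}) (radial_field i)"
  unfolding radial_field_def divide_inverse
  by (intro C1_on_mult C1_on_power C1_on_component C1_on_model)

text \<open>The field is \<open>g (norm x)\<close> times \<open>x\<close>, and its flat divergence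
  is \<open>n * g t + t * g' t\<close>. In this sum the terms from differentiating the powers of
  \<open>1 / t\<close> cancel.\<close>

lemma divergence_radial_field:
  assumes x: "x \<noteq> 0"
  shows "(\<Sum>i\<in>UNIV. partial i (radial_field i) x) = sqrt (det (G x)) * radial_laplacian (norm x)"
proof -
  \<comment> \<open>Dimension at least 2 gives \<open>N = Suc m\<close>, so the derivative of the
    \<open>N\<close>-th power can be written with exponent \<open>m\<close>.\<close>
  define m where "m = N - 1"
  have Suc: "N = Suc m" "CARD('n) = Suc N" using card by (auto simp: N m_def)
  define t where "t = norm x"
  have t: "t > 0" using x by (simp add: t_def)
  define g where "g t = (r t / t) ^ N * (u' t / t)" for t
  define g' where "g' = (r t / t) ^ N * ((u'' t * t - u' t) / (t * t)) +
    real N * ((r' t * t - r t) / (t * t) * (r t / t) ^ m) * (u' t / t)"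
  have g: "(g has_real_derivative g') (at t)"
  proof -
    have "((\<lambda>t. r t / t) has_real_derivative (r' t * t - r t) / (t * t)) (at t)"
      using DERIV_divide[OF r'(1)[OF t] DERIV_ident] t by simp
    from DERIV_power[OF this, of N]
    have 1: "((\<lambda>t. (r t / t) ^ N) has_real_derivative real N * ((r' t * t - r t) / (t * t) * (r t / t) ^ m)) (at t)"
      by (simp add: m_def)
    have 2: "((\<lambda>t. u' t / t) has_real_derivative (u'' t * t - u' t) / (t * t)) (at t)"
      using DERIV_divide[OF u''(1)[of t] DERIV_ident] t by simp
    show ?thesis using DERIV_mult'[OF 1 2] unfolding g_def g'_def .
  qed
  have "partial i (radial_field i) x = g t + g' * ((x $ i)\<^sup>2 / t)" for i
  proof -
    have "radial_field i = (\<lambda>x. g (norm x) * x $ i)"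
      by (simp add: radial_field_def g_def fun_eq_iff N)
    moreover have "(\<lambda>x. g (norm x)) differentiable (at x)"
      using has_derivative_radial[OF g[unfolded t_def] x] differentiableI by blast
    moreover have "(\<lambda>x. x $ i) differentiable (at x)"
      using C1_on_component[of UNIV i] by (rule C1_onD) simp
    ultimately show ?thesis
      using partial_radial[OF g[unfolded t_def] x, of i]
      by (simp add: partial_mult partial_component t_def power2_eq_square)
  qed
  then have "(\<Sum>i\<in>UNIV. partial i (radial_field i) x) = real CARD('n) * g t + g' * ((\<Sum>i\<in>UNIV. (x $ i)\<^sup>2) / t)"
    by (simp add: sum.distrib sum_distrib_left sum_divide_distrib)
  also have "(\<Sum>i\<in>UNIV. (x $ i)\<^sup>2) = t * t"
    using power2_norm_eq_inner[of x] by (simp add: t_def inner_vec_def power2_eq_square)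
  also have "real CARD('n) * g t + g' * (t * t / t) = (r t / t) ^ N * radial_laplacian t"
  proof -
    define q where "q = (r t / t) ^ m"
    have R: "r t > 0" using r_pos[OF t] .
    show ?thesis
      unfolding radial_laplace_def Suc(2) g_def g'_def unfolding Suc(1) power_Suc q_def[symmetric]
      using t R by (simp add: field_simps)
  qed
  finally show ?thesis
    using sqrt_det_model_metric[OF M x] by (simp add: t_def N)
qed

text \<open>The inverse metric fixes the radial direction, so both sides are the density times
  \<open>u' t / t\<close> times the Euclidean product of \<open>x\<close> with the partial
  derivatives of \<open>\<phi>\<close>. These are the cross terms that cancel in Green's
  identity.\<close>

lemma radial_gradient_symmetric:
  assumes x: "x \<noteq> 0"
  shows "(\<Sum>i\<in>UNIV. partial i (\<lambda>x. u (norm x)) x * gradient_field \<phi> i x) =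
    (\<Sum>i\<in>UNIV. partial i \<phi> x * radial_field i x)"
proof -
  define t where "t = norm x"
  have t: "t > 0" using x by (simp add: t_def)
  let ?s = "sqrt (det (G x))" and ?d = "\<chi> i. partial i \<phi> x"
  have "(\<Sum>i\<in>UNIV. partial i (\<lambda>x. u (norm x)) x * gradient_field \<phi> i x) =
      ?s * (u' t / t) * (x \<bullet> gradient G \<phi> x)"
    by (simp add: partial_radial[OF u' x] gradient_field_def inner_vec_def sum_distrib_left t_def mult_ac)
  also have "x \<bullet> gradient G \<phi> x = x \<bullet> ?d"
    unfolding gradient_def model_metric_inverse_mult[OF M x] inner_add_right inner_diff_right inner_scaleR_right
      power2_norm_eq_inner using x by simp
  also have "?s * (u' t / t) * (x \<bullet> ?d) = (\<Sum>i\<in>UNIV. partial i \<phi> x * radial_field i x)"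
    by (simp add: sqrt_det_model_metric[OF M x] radial_field_def inner_vec_def sum_distrib_left sum_distrib_right
        sum_divide_distrib t_def mult_ac)
  finally show ?thesis .
qed

text \<open>
  Green's identity is the divergence theorem for \<open>Z = u grad \<phi> - \<phi> grad u\<close> (times the volume density).
\<close>

lemma green_radial:
  assumes \<phi>: "smooth \<phi>"
  defines "Z \<equiv> \<lambda>i x. u (norm x) * gradient_field \<phi> i x - \<phi> x * radial_field i x"
  shows "has_bochner_integral lborel (\<lambda>x. \<Sum>i\<in>UNIV. partial i (Z i) x) 0"
    and "\<And>x. x \<noteq> 0 \<Longrightarrow> (\<Sum>i\<in>UNIV. partial i (Z i) x) =
      sqrt (det (G x)) * (u (norm x) * laplacian G \<phi> x) - sqrt (det (G x)) * (radial_laplacian (norm x) * \<phi> x)"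
proof -
  note C1 = C1_on_gradient_field[OF \<phi>] C1_on_radial_field C1_on_model(5) smooth_imp_C1_on[OF \<phi>]
  have "has_bochner_integral lborel (partial i (Z i)) 0" for i
  proof (rule integral_partial_eq_0)
    show "C1_on UNIV (Z i)"
    \<comment> \<open>Below radius \<open>a\<close> both \<open>u\<close> and \<open>u'\<close>
      vanish, which removes the singularity at the pole.\<close>
    proof (rule C1_on_UNIV_if_vanishing[OF _ _ a])
      show "C1_on (-{0}) (Z i)" unfolding Z_def by (intro C1_on_diff C1_on_mult C1)
      show "Z i x = 0" if "norm x < a" for x
        using supp[of "norm x"] that by (simp add: Z_def radial_field_def)
    qed
    show "Z i x = 0" if "norm x > b" for x
      using supp[of "norm x"] that by (simp add: Z_def radial_field_def)
  qed
  then have "has_bochner_integral lborel (\<lambda>x. \<Sum>i\<in>UNIV. partial i (Z i) x) (\<Sum>i\<in>(UNIV::'n set). 0)"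
    by (intro has_bochner_integral_sum)
  then show "has_bochner_integral lborel (\<lambda>x. \<Sum>i\<in>UNIV. partial i (Z i) x) 0" by simp
  fix x :: "real^'n" assume x: "x \<noteq> 0"
  have s: "sqrt (det (G x)) \<noteq> 0"
    using x r_pos[of "norm x"] by (simp add: sqrt_det_model_metric[OF M x])
  have d: "f differentiable (at x)" if "C1_on (-{0}) f" for f :: "real^'n \<Rightarrow> real"
    by (rule C1_onD[OF that]) (use x in simp)
  note D = d[OF C1(1)] d[OF C1(2)] d[OF C1(3)] d[OF C1(4)]
  have "partial i (Z i) x =
      (u (norm x) * partial i (gradient_field \<phi> i) x + partial i (\<lambda>x. u (norm x)) x * gradient_field \<phi> i x) -
      (\<phi> x * partial i (radial_field i) x + partial i \<phi> x * radial_field i x)" for i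
    unfolding Z_def by (simp add: partial_diff partial_mult D)
  then have "(\<Sum>i\<in>UNIV. partial i (Z i) x) =
      (u (norm x) * (\<Sum>i\<in>UNIV. partial i (gradient_field \<phi> i) x)
        + (\<Sum>i\<in>UNIV. partial i (\<lambda>x. u (norm x)) x * gradient_field \<phi> i x)) -
      (\<phi> x * (\<Sum>i\<in>UNIV. partial i (radial_field i) x) + (\<Sum>i\<in>UNIV. partial i \<phi> x * radial_field i x))"
    by (simp add: sum.distrib sum_subtractf sum_distrib_left)
  also have "(\<Sum>i\<in>UNIV. partial i (gradient_field \<phi> i) x) = sqrt (det (G x)) * laplacian G \<phi> x"
    using s by (simp add: laplacian_def divergence_def gradient_field_def[abs_def])
  finally show "(\<Sum>i\<in>UNIV. partial i (Z i) x) =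
      sqrt (det (G x)) * (u (norm x) * laplacian G \<phi> x) - sqrt (det (G x)) * (radial_laplacian (norm x) * \<phi> x)"
    unfolding radial_gradient_symmetric[OF x] divergence_radial_field[OF x] by (simp add: algebra_simps)
qed

text \<open>The support keeps away from the pole, so continuity on \<open>{0<..}\<close> suffices.
  Squared norms become one-dimensional integrals with weight \<open>r^(n - 1)\<close>, up to the
  area of the unit sphere.\<close>

lemma
  fixes F :: "real \<Rightarrow> real"
  assumes F: "continuous_on {0<..} F" and suppF: "\<And>t. t \<notin> {a..b} \<Longrightarrow> F t = 0"
  shows integrable_radial: "integrable lborel (\<lambda>t. indicator {0<..} t * (r t ^ m * F t))"
    and L2_radial: "(\<lambda>x. complex_of_real (F (norm x))) \<in> L2 (volume_measure G)"
    and L2_norm_radial: "(L2_norm (volume_measure G) (\<lambda>x. complex_of_real (F (norm x))))\<^sup>2 =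
      real CARD('n) * unit_ball_vol (real CARD('n)) *
      (\<integral>t. indicator {0<..} t * (r t ^ (CARD('n) - 1) * (F t)\<^sup>2) \<partial>lborel)"
proof -
  have Ft: "t \<in> {a..b}" if "F t \<noteq> 0" for t using suppF that by blast
  have F': "continuous_on {a..b} F" "continuous_on {a..b} r"
    by (rule continuous_on_subset[OF F] continuous_on_subset[OF continuous_on_u(4)], use a in auto)+
  have "(\<lambda>t. indicator {a..b} t *\<^sub>R F t) \<in> borel_measurable borel"
    by (rule borel_measurable_continuous_on_indicator[OF _ F'(1)]) simp
  also have "(\<lambda>t. indicator {a..b} t *\<^sub>R F t) = F"
    using Ft by (auto simp: indicator_def fun_eq_iff)
  finally have mF: "F \<in> borel_measurable borel" .
  have "integrable lborel (\<lambda>t. indicator {a..b} t *\<^sub>R (r t ^ m * F t))"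
    by (rule borel_integrable_compact) (auto intro!: continuous_intros F')
  also have "(\<lambda>t. indicator {a..b} t *\<^sub>R (r t ^ m * F t)) = (\<lambda>t. indicator {0<..} t * (r t ^ m * F t))"
  proof
    fix t show "indicator {a..b} t *\<^sub>R (r t ^ m * F t) = indicator {0<..} t * (r t ^ m * F t)"
      using Ft[of t] a by (cases "F t = 0") (auto simp: indicator_def)
  qed
  finally show "integrable lborel (\<lambda>t. indicator {0<..} t * (r t ^ m * F t))" .
  have G: "riemannian_metric G" using M unfolding model_manifold_def by (elim conjE)
  have Fn: "continuous_on (-{0}) (\<lambda>x::real^'n. F (norm x))"
    by (rule continuous_on_compose2[OF F]) (auto intro!: continuous_intros)
  have "integrable lborel (\<lambda>x. sqrt (det (G x)) *\<^sub>R (F (norm x))\<^sup>2)"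
    by (rule integrable_annulus[OF _ _ a])
      (use suppF in \<open>auto intro!: continuous_on_mult continuous_on_power continuous_sqrt_det[OF G] Fn\<close>)
  moreover have m2: "(\<lambda>t. (F t)\<^sup>2) \<in> borel_measurable borel" "(\<lambda>x::real^'n. (F (norm x))\<^sup>2) \<in> borel_measurable borel"
    using mF by measurable
  ultimately have "integrable (volume_measure G) (\<lambda>x. (F (norm x))\<^sup>2)"
    by (simp only: integral_volume_measure(2)[OF M])
  moreover have "(\<lambda>x::real^'n. complex_of_real (F (norm x))) \<in> borel_measurable (volume_measure G)"
    unfolding volume_measure_def using mF by measurable
  ultimately show "(\<lambda>x. complex_of_real (F (norm x))) \<in> L2 (volume_measure G)"
    by (simp add: L2_def)
  have "(L2_norm (volume_measure G) (\<lambda>x. complex_of_real (F (norm x))))\<^sup>2 =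
    (\<integral>x. (F (norm x))\<^sup>2 \<partial>volume_measure G)"
    by (simp add: L2_norm_def)
  also have "\<dots> = real CARD('n) * unit_ball_vol (real CARD('n)) *
      (\<integral>t. indicator {0<..} t * (r t ^ (CARD('n) - 1) * (F t)\<^sup>2) \<partial>lborel)"
    by (rule integral_volume_measure_radial[OF M m2(1)])
  finally show "(L2_norm (volume_measure G) (\<lambda>x. complex_of_real (F (norm x))))\<^sup>2 =
      real CARD('n) * unit_ball_vol (real CARD('n)) *
      (\<integral>t. indicator {0<..} t * (r t ^ (CARD('n) - 1) * (F t)\<^sup>2) \<partial>lborel)" .
qed

section \<open>Radial functions in the domain of the Laplacian\<close>

lemma radial_laplacian_eq_0: "t \<notin> {a..b} \<Longrightarrow> radial_laplacian t = 0"
  using supp[of t] by (simp add: radial_laplace_def)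

text \<open>Off the pole the two integrands, multiplied by the density, differ by the divergence in
  Green's identity, whose integral is 0.\<close>

lemma laplace_graph_radial:
  "laplace_graph G (\<lambda>x. complex_of_real (u (norm x))) (\<lambda>x. complex_of_real (radial_laplacian (norm x)))"
  unfolding laplace_graph_def
proof (intro conjI allI impI)
  show "(\<lambda>x. complex_of_real (u (norm x))) \<in> L2 (volume_measure G)"
    by (rule L2_radial[OF continuous_on_u(1)]) (use supp in blast)
  show "(\<lambda>x. complex_of_real (radial_laplacian (norm x))) \<in> L2 (volume_measure G)"
    by (rule L2_radial[OF continuous_on_radial_laplacian radial_laplacian_eq_0])
  fix \<phi> :: "real^'n \<Rightarrow> real" assume "test_function \<phi>"
  then have \<phi>: "smooth \<phi>" by (simp add: test_function_def)
  define Z where "Z i x = u (norm x) * gradient_field \<phi> i x - \<phi> x * radial_field i x" for i x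
  let ?s = "\<lambda>x. sqrt (det (G x))" and ?h = "\<lambda>x::real^'n. radial_laplacian (norm x)"
  have Z: "has_bochner_integral lborel (\<lambda>x. \<Sum>i\<in>UNIV. partial i (Z i) x) 0"
    "\<And>x. x \<noteq> 0 \<Longrightarrow> (\<Sum>i\<in>UNIV. partial i (Z i) x) = ?s x * (u (norm x) * laplacian G \<phi> x) - ?s x * (?h x * \<phi> x)"
    using green_radial[OF \<phi>] unfolding Z_def[abs_def] by blast+
  have G: "riemannian_metric G" using M unfolding model_manifold_def by (elim conjE)
  have s0: "?s x \<noteq> 0" if "x \<noteq> 0" for x
    using that r_pos[of "norm x"] by (simp add: sqrt_det_model_metric[OF M that])
  have s: "?s \<in> borel_measurable borel"
    by (rule borel_measurable_continuous_onI) (rule continuous_sqrt_det[OF G])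
  have ch: "continuous_on (-{0}) ?h"
    by (rule continuous_on_compose2[OF continuous_on_radial_laplacian]) (auto intro!: continuous_intros)
  have c\<phi>: "continuous_on (-{0}) \<phi>"
    using smooth_imp_C1_on[OF \<phi>] by (rule C1_on_continuous)
  have "continuous_on (-{0}) (laplacian G \<phi>)"
    unfolding laplacian_def divergence_def gradient_field_def[symmetric, abs_def]
    by (intro continuous_on_divide continuous_on_sum continuous_sqrt_det[OF G]
        C1_on_partial[OF C1_on_gradient_field[OF \<phi>]] ballI s0) simp
  then have "continuous_on (-{0}) (\<lambda>x. u (norm x) * laplacian G \<phi> x)"
    by (intro continuous_on_mult C1_on_continuous[OF C1_on_model(5)])
  then have m\<Delta>: "(\<lambda>x. u (norm x) * laplacian G \<phi> x) \<in> borel_measurable borel"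
    by (rule measurable_annulus[OF _ _ a]) (use supp in auto)
  have mh: "(\<lambda>x. ?h x * \<phi> x) \<in> borel_measurable borel"
    by (rule measurable_annulus[OF continuous_on_mult[OF ch c\<phi>], of a b]) (use radial_laplacian_eq_0 a in simp_all)
  have ih: "integrable lborel (\<lambda>x. ?s x * (?h x * \<phi> x))"
    by (rule integrable_annulus[OF continuous_on_mult[OF continuous_sqrt_det[OF G] continuous_on_mult[OF ch c\<phi>]], of a b])
      (use radial_laplacian_eq_0 a in simp_all)
  have "(\<integral>x. u (norm x) * laplacian G \<phi> x \<partial>volume_measure G) = (\<integral>x. ?s x * (u (norm x) * laplacian G \<phi> x) \<partial>lborel)"
    using integral_volume_measure(1)[OF M m\<Delta>] by simp
  also have "\<dots> = (\<integral>x. (\<Sum>i\<in>UNIV. partial i (Z i) x) + ?s x * (?h x * \<phi> x) \<partial>lborel)"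
  proof (rule Bochner_Integration.integral_cong_AE)
    show "AE x in lborel. ?s x * (u (norm x) * laplacian G \<phi> x) =
      (\<Sum>i\<in>UNIV. partial i (Z i) x) + ?s x * (?h x * \<phi> x)"
      using AE_lborel_singleton[of 0] by eventually_elim (simp add: Z(2))
    show "(\<lambda>x. ?s x * (u (norm x) * laplacian G \<phi> x)) \<in> borel_measurable lborel"
      using s m\<Delta> by simp
    show "(\<lambda>x. (\<Sum>i\<in>UNIV. partial i (Z i) x) + ?s x * (?h x * \<phi> x)) \<in> borel_measurable lborel"
      using borel_measurable_has_bochner_integral[OF Z(1)] borel_measurable_integrable[OF ih]
      by (rule borel_measurable_add)
  qed
  also have "\<dots> = (\<integral>x. ?s x * (?h x * \<phi> x) \<partial>lborel)"
    using Z(1) ih by (simp add: has_bochner_integral_iff)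
  also have "\<dots> = (\<integral>x. ?h x * \<phi> x \<partial>volume_measure G)"
    using integral_volume_measure(1)[OF M mh] by simp
  finally have "(\<integral>x. u (norm x) * laplacian G \<phi> x \<partial>volume_measure G) = (\<integral>x. ?h x * \<phi> x \<partial>volume_measure G)" .
  then show "(\<integral>x. complex_of_real (u (norm x)) * complex_of_real (laplacian G \<phi> x) \<partial>volume_measure G) =
      (\<integral>x. complex_of_real (?h x) * complex_of_real (\<phi> x) \<partial>volume_measure G)"
    by (simp flip: of_real_mult)
qed

text \<open>The assumed estimate is applied to \<open>u (norm x)\<close> and its image under
  \<open>\<Delta> + l\<close>. The area of the unit sphere is a positive factor of both sides and
  cancels.\<close>

lemma radial_spectral_bound:
  assumes K: "\<And>f h. laplace_graph G f (\<lambda>x. h x - complex_of_real l * f x) \<Longrightarrow>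
      f \<in> L2 (volume_measure G) \<Longrightarrow> h \<in> L2 (volume_measure G) \<Longrightarrow>
      (L2_norm (volume_measure G) f)\<^sup>2 \<le> K * (L2_norm (volume_measure G) h)\<^sup>2"
  shows "(\<integral>t. indicator {0<..} t * (r t ^ (CARD('n) - 1) * (u t)\<^sup>2) \<partial>lborel) \<le>
    K * (\<integral>t. indicator {0<..} t * (r t ^ (CARD('n) - 1) * (radial_laplacian t + l * u t)\<^sup>2) \<partial>lborel)"
proof -
  let ?F = "\<lambda>t. radial_laplacian t + l * u t"
  let ?f = "\<lambda>x::real^'n. complex_of_real (u (norm x))"
  let ?h = "\<lambda>x::real^'n. complex_of_real (?F (norm x))"
  have F: "continuous_on {0<..} ?F"
    by (intro continuous_on_add continuous_on_mult continuous_on_const continuous_on_radial_laplacian continuous_on_u)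
  have F0: "?F t = 0" if "t \<notin> {a..b}" for t
    using supp[OF that] radial_laplacian_eq_0[OF that] by simp
  have u0: "u t = 0" if "t \<notin> {a..b}" for t using supp[OF that] by simp
  have "(\<lambda>x. ?h x - complex_of_real l * ?f x) = (\<lambda>x. complex_of_real (radial_laplacian (norm x)))"
    by (simp add: fun_eq_iff)
  then have graph: "laplace_graph G ?f (\<lambda>x. ?h x - complex_of_real l * ?f x)"
    using laplace_graph_radial by simp
  let ?c = "real CARD('n) * unit_ball_vol (real CARD('n))"
  let ?I = "\<lambda>F. \<integral>t. indicator {0<..} t * (r t ^ (CARD('n) - 1) * (F t)\<^sup>2) \<partial>lborel"
  have L2: "?f \<in> L2 (volume_measure G)" "?h \<in> L2 (volume_measure G)"
    by (rule L2_radial, rule continuous_on_u F, erule u0 F0)+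
  have norm: "(L2_norm (volume_measure G) ?f)\<^sup>2 = ?c * ?I u" "(L2_norm (volume_measure G) ?h)\<^sup>2 = ?c * ?I ?F"
    by (rule L2_norm_radial, rule continuous_on_u F, erule u0 F0)+
  have "?c * ?I u \<le> ?c * (K * ?I ?F)"
    using K[OF graph L2] unfolding norm by (simp only: mult.left_commute[of K])
  moreover have "real CARD('n) * unit_ball_vol (real CARD('n)) > 0" by simp
  ultimately show ?thesis by (rule mult_left_le_imp_le)
qed

end

section \<open>Approximate eigenfunctions\<close>

text \<open>If \<open>T f h\<close>, the inverse maps \<open>h\<close> to \<open>f\<close> almost
  everywhere, so its bound is an estimate for \<open>f\<close>. Squaring supplies the nonnegative
  constant \<open>C^2\<close> whatever the sign of \<open>C\<close>.\<close>

lemma has_bounded_inverseE: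
  assumes "has_bounded_inverse N T"
  obtains K where "K \<ge> 0"
    "\<And>f h. T f h \<Longrightarrow> f \<in> L2 N \<Longrightarrow> h \<in> L2 N \<Longrightarrow> (L2_norm N f)\<^sup>2 \<le> K * (L2_norm N h)\<^sup>2"
proof -
  obtain R C where R: "\<And>h. h \<in> L2 N \<Longrightarrow> R h \<in> L2 N" "\<And>f h. T f h \<Longrightarrow> AE x in N. R h x = f x"
    and C: "\<And>h. h \<in> L2 N \<Longrightarrow> L2_norm N (R h) \<le> C * L2_norm N h"
    using assms unfolding has_bounded_inverse_def by blast
  have "(L2_norm N f)\<^sup>2 \<le> C\<^sup>2 * (L2_norm N h)\<^sup>2" if "T f h" "f \<in> L2 N" "h \<in> L2 N" for f h
  proof -
    have "(\<integral>x. (cmod (R h x))\<^sup>2 \<partial>N) = (\<integral>x. (cmod (f x))\<^sup>2 \<partial>N)"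
    proof (rule Bochner_Integration.integral_cong_AE)
      show "AE x in N. (cmod (R h x))\<^sup>2 = (cmod (f x))\<^sup>2"
        using R(2)[OF that(1)] by eventually_elim simp
    qed (use R(1)[OF that(3)] that(2) in \<open>auto simp: L2_def dest: borel_measurable_integrable\<close>)
    then have "L2_norm N f \<le> C * L2_norm N h"
      using C[OF that(3)] by (simp add: L2_norm_def)
    moreover have "0 \<le> L2_norm N f" by (simp add: L2_norm_def)
    ultimately show ?thesis by (simp add: power_mono flip: power_mult_distrib)
  qed
  then show ?thesis using that[of "C\<^sup>2"] by simp
qed

text \<open>Away from 0 the function is locally a polynomial. At 0 the difference quotient is
  \<open>max 0 h ^ Suc n\<close>, which tends to 0.\<close>

lemma DERIV_max_0_power:
  "((\<lambda>x::real. max 0 x ^ Suc (Suc n)) has_real_derivative real (Suc (Suc n)) * max 0 x ^ Suc n) (at x)"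
proof -
  consider "x > 0" | "x < 0" | "x = 0" by linarith
  then show ?thesis
  proof cases
    case 1
    have "((\<lambda>x::real. x ^ Suc (Suc n)) has_real_derivative real (Suc (Suc n)) * max 0 x ^ Suc n) (at x)"
      using DERIV_pow[of "Suc (Suc n)" x] 1 by simp
    then show ?thesis
      by (rule has_field_derivative_transform_within_open[of _ _ _ "{0<..}"]) (use 1 in auto)
  next
    case 2
    have "((\<lambda>x::real. 0) has_real_derivative real (Suc (Suc n)) * max 0 x ^ Suc n) (at x)"
      using 2 by simp
    then show ?thesis
      by (rule has_field_derivative_transform_within_open[of _ _ _ "{..<0}"]) (use 2 in auto)
  next
    case 3
    have "((\<lambda>h::real. max 0 h ^ Suc n) \<longlongrightarrow> max 0 0 ^ Suc n) (at 0)"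
      by (intro tendsto_intros)
    moreover have "max 0 h ^ Suc n = (max 0 (0 + h) ^ Suc (Suc n) - max 0 0 ^ Suc (Suc n)) / h" if "h \<noteq> 0" for h :: real
      using that by (simp add: max_def)
    ultimately have "((\<lambda>h::real. (max 0 (0 + h) ^ Suc (Suc n) - max 0 0 ^ Suc (Suc n)) / h) \<longlongrightarrow> 0) (at 0)"
      by (subst Lim_cong_within[OF refl refl refl, of 0 UNIV _ "\<lambda>h. max 0 h ^ Suc n"]) simp_all
    then show ?thesis by (simp add: DERIV_def 3)
  qed
qed

text \<open>
  The truncation \<open>max 0\<close> of a concave parabola, cubed, is a \<open>C\<^sup>2\<close> bump supported in \<open>[a, a + L]\<close>.
\<close>

definition bump_base :: "real \<Rightarrow> real \<Rightarrow> real \<Rightarrow> real" where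
  "bump_base a L t = (t - a) * (a + L - t) / L\<^sup>2"

definition bump_slope :: "real \<Rightarrow> real \<Rightarrow> real \<Rightarrow> real" where
  "bump_slope a L t = (2 * a + L - 2 * t) / L\<^sup>2"

definition bump :: "nat \<Rightarrow> real \<Rightarrow> real \<Rightarrow> real \<Rightarrow> real" where
  "bump n a L t = max 0 (bump_base a L t) ^ n"

text \<open>The phases 0 and \<open>- (pi / 2)\<close> give a cosine and a sine in place of a
  complex exponential, which keeps the trial functions real.\<close>

definition wave :: "real \<Rightarrow> real \<Rightarrow> real \<Rightarrow> real \<Rightarrow> real \<Rightarrow> real" where
  "wave k \<theta> a L t = bump 3 a L t * cos (k * t + \<theta>)"

definition wave' :: "real \<Rightarrow> real \<Rightarrow> real \<Rightarrow> real \<Rightarrow> real \<Rightarrow> real" where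
  "wave' k \<theta> a L t = 3 * bump 2 a L t * bump_slope a L t * cos (k * t + \<theta>)
    - k * bump 3 a L t * sin (k * t + \<theta>)"

text \<open>\<open>wave_defect\<close> is \<open>u'' + k\<^sup>2 u\<close> for \<open>u = wave k \<theta> a L\<close>.\<close>

definition wave_defect :: "real \<Rightarrow> real \<Rightarrow> real \<Rightarrow> real \<Rightarrow> real \<Rightarrow> real" where
  "wave_defect k \<theta> a L t =
    (6 * bump 1 a L t * (bump_slope a L t)\<^sup>2 - 6 * bump 2 a L t / L\<^sup>2) * cos (k * t + \<theta>)
    - 6 * k * bump 2 a L t * bump_slope a L t * sin (k * t + \<theta>)"

section \<open>Derivatives and estimates of the cut-off waves\<close>

lemma DERIV_bump_base: "(bump_base a L has_real_derivative bump_slope a L t) (at t)"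
proof -
  have "((\<lambda>t. (t - a) * (a + L - t)) has_real_derivative 2 * a + L - 2 * t) (at t)"
    by (auto intro!: derivative_eq_intros)
  then show ?thesis
    unfolding bump_base_def[abs_def] bump_slope_def by (rule DERIV_cdivide)
qed

lemma DERIV_bump_slope: "(bump_slope a L has_real_derivative - 2 / L\<^sup>2) (at t)"
proof -
  have "((\<lambda>t. 2 * a + L - 2 * t) has_real_derivative - 2) (at t)"
    by (auto intro!: derivative_eq_intros)
  then show ?thesis
    unfolding bump_slope_def[abs_def] by (rule DERIV_cdivide)
qed

lemma DERIV_bump:
  "(bump (Suc (Suc n)) a L has_real_derivative real (Suc (Suc n)) * bump (Suc n) a L t * bump_slope a L t) (at t)"
  unfolding bump_def by (rule DERIV_chain2[OF DERIV_max_0_power DERIV_bump_base])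

lemma DERIV_wave: "(wave k \<theta> a L has_real_derivative wave' k \<theta> a L t) (at t)"
proof -
  have b: "(bump 3 a L has_real_derivative 3 * bump 2 a L t * bump_slope a L t) (at t)"
    using DERIV_bump[of 1 a L t] by (simp add: eval_nat_numeral)
  show ?thesis
    unfolding wave_def wave'_def
    by (rule derivative_eq_intros b refl)+ (simp add: algebra_simps)
qed

lemma DERIV_wave': "(wave' k \<theta> a L has_real_derivative wave_defect k \<theta> a L t - k\<^sup>2 * wave k \<theta> a L t) (at t)"
proof -
  have b: "(bump 3 a L has_real_derivative 3 * bump 2 a L t * bump_slope a L t) (at t)"
    "(bump 2 a L has_real_derivative 2 * bump 1 a L t * bump_slope a L t) (at t)"
    using DERIV_bump[of 1 a L t] DERIV_bump[of 0 a L t] by (simp_all add: eval_nat_numeral)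
  show ?thesis
    unfolding wave'_def wave_def wave_defect_def
    by (rule derivative_eq_intros b DERIV_bump_slope refl)+ (simp add: algebra_simps power2_eq_square)
qed

lemma continuous_on_wave_defect: "continuous_on S (wave_defect k \<theta> a L)"
proof -
  have b: "continuous_on S (bump n a L)" "continuous_on S (bump_slope a L)" for n
    unfolding bump_def bump_base_def bump_slope_def divide_inverse by (intro continuous_intros)+
  show ?thesis unfolding wave_defect_def divide_inverse
    by (intro continuous_intros b)
qed

lemma bump_slope_bound:
  assumes "L > 0" "t \<in> {a..a+L}"
  shows "\<bar>bump_slope a L t\<bar> \<le> 1 / L"
proof -
  have "\<bar>2 * a + L - 2 * t\<bar> \<le> L" using assms by auto
  then have "\<bar>2 * a + L - 2 * t\<bar> / L\<^sup>2 \<le> L / L\<^sup>2" by (rule divide_right_mono) simp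
  then show ?thesis using assms by (simp add: bump_slope_def power2_eq_square)
qed

lemma bump_eq_0:
  assumes "L > 0" "t \<notin> {a..a+L}" "n > 0"
  shows "bump n a L t = 0"
proof -
  have "(t - a) * (a + L - t) \<le> 0"
    using assms by (auto simp: mult_le_0_iff)
  then have "bump_base a L t \<le> 0" by (simp add: bump_base_def divide_le_0_iff)
  then show ?thesis using assms by (simp add: bump_def max_def)
qed

lemma wave_eq_0:
  assumes "L > 0" "t \<notin> {a..a+L}"
  shows "wave k \<theta> a L t = 0" "wave' k \<theta> a L t = 0" "wave_defect k \<theta> a L t = 0"
  using bump_eq_0[OF assms] by (simp_all add: wave_def wave'_def wave_defect_def)

lemma bump_bounds:
  assumes "L \<ge> 1"
  shows "0 \<le> bump n a L t" "bump n a L t \<le> 1"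
    and "n > 0 \<Longrightarrow> \<bar>bump n a L t * bump_slope a L t\<bar> \<le> 1 / L"
proof -
  have "(t - a) * (a + L - t) \<le> L\<^sup>2"
  proof -
    \<comment> \<open>With \<open>s = t - a\<close> this is \<open>L^2 - s * (L - s)\<close>,
      written as a sum of squares.\<close>
    have "0 \<le> (t - a - L / 2)\<^sup>2 + 3 / 4 * L\<^sup>2" by simp
    then show ?thesis by (simp add: power2_eq_square algebra_simps)
  qed
  then have "bump_base a L t \<le> 1" using assms by (simp add: bump_base_def)
  then show b: "0 \<le> bump n a L t" "bump n a L t \<le> 1"
    by (auto simp: bump_def intro!: power_le_one)
  assume n: "n > 0"
  show "\<bar>bump n a L t * bump_slope a L t\<bar> \<le> 1 / L"
  \<comment> \<open>The slope is at most \<open>1 / L\<close> in absolute value on the interval;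
    outside, it is unbounded but the bump vanishes.\<close>
  proof (cases "t \<in> {a..a+L}")
    case True
    then have s: "\<bar>bump_slope a L t\<bar> \<le> 1 / L"
      using assms by (intro bump_slope_bound) auto
    have "\<bar>bump n a L t * bump_slope a L t\<bar> = bump n a L t * \<bar>bump_slope a L t\<bar>"
      using b by (simp add: abs_mult)
    also have "\<dots> \<le> 1 * (1 / L)" by (rule mult_mono) (use b s in auto)
    finally show ?thesis by simp
  next
    case False
    then show ?thesis using assms n by (simp add: bump_eq_0)
  qed
qed

lemma wave'_bound:
  assumes L: "L \<ge> 1" and k: "k \<ge> 0"
  shows "\<bar>wave' k \<theta> a L t\<bar> \<le> 3 + k"
proof -
  have "1 / L \<le> 1" using L by simp
  then have 1: "\<bar>bump 2 a L t * bump_slope a L t\<bar> \<le> 1"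
    using bump_bounds(3)[OF L, of 2 a t] by linarith
  have "\<bar>wave' k \<theta> a L t\<bar> \<le> \<bar>3 * (bump 2 a L t * bump_slope a L t) * cos (k * t + \<theta>)\<bar>
      + \<bar>k * bump 3 a L t * sin (k * t + \<theta>)\<bar>"
    unfolding wave'_def mult.assoc by (rule abs_triangle_ineq4)
  also have "\<dots> \<le> 3 * 1 * 1 + k * 1 * 1"
    unfolding abs_mult using 1 k bump_bounds[OF L, of 3 a t]
    by (intro add_mono mult_mono) (auto simp: abs_mult)
  finally show ?thesis by simp
qed

text \<open>With \<open>k^2 u\<close> cancelled, every remaining term contains a derivative of the
  cut-off and hence a factor \<open>1 / L\<close>. The two cosine terms contribute 6 each, the sine
  term \<open>6 * k\<close>.\<close>

lemma wave_defect_bound: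
  assumes L: "L \<ge> 1" and k: "k \<ge> 0"
  shows "\<bar>wave_defect k \<theta> a L t\<bar> \<le> (12 + 6 * k) / L"
proof -
  have L1: "1 / L \<le> 1" "1 / L\<^sup>2 \<le> 1 / L" "1 / L \<ge> 0" using L by (auto simp: power2_eq_square divide_simps)
  note b = bump_bounds(3)[OF L, of 1 a t] bump_bounds(3)[OF L, of 2 a t] bump_bounds(1,2)[OF L, of 2 a t]
  have s: "bump 1 a L t * (bump_slope a L t)\<^sup>2 \<le> 1 / L"
  proof (cases "t \<in> {a..a+L}")
    case True
    then have "\<bar>bump_slope a L t\<bar> \<le> 1"
      using bump_slope_bound[of L t a] L L1(1) by linarith
    have "bump 1 a L t * (bump_slope a L t)\<^sup>2 = \<bar>bump 1 a L t * bump_slope a L t\<bar> * \<bar>bump_slope a L t\<bar>"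
      using bump_bounds(1)[OF L, of 1 a t] by (simp add: abs_mult power2_eq_square)
    also have "\<dots> \<le> 1 / L * 1" by (rule mult_mono) (use b L1 \<open>\<bar>bump_slope a L t\<bar> \<le> 1\<close> in auto)
    finally show ?thesis by simp
  next
    case False
    then show ?thesis using L by (simp add: bump_eq_0)
  qed
  have "0 \<le> bump 1 a L t * (bump_slope a L t)\<^sup>2" using bump_bounds(1)[OF L, of 1 a t] by simp
  moreover have "0 \<le> bump 2 a L t / L\<^sup>2" "bump 2 a L t / L\<^sup>2 \<le> 1 / L\<^sup>2"
    using b by (auto simp: divide_right_mono)
  ultimately have 1: "\<bar>6 * bump 1 a L t * (bump_slope a L t)\<^sup>2 - 6 * bump 2 a L t / L\<^sup>2\<bar> \<le> 12 / L"
    using s L1 by (auto simp: abs_le_iff algebra_simps)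
  have "\<bar>wave_defect k \<theta> a L t\<bar> \<le>
      \<bar>(6 * bump 1 a L t * (bump_slope a L t)\<^sup>2 - 6 * bump 2 a L t / L\<^sup>2) * cos (k * t + \<theta>)\<bar>
      + \<bar>6 * k * (bump 2 a L t * bump_slope a L t) * sin (k * t + \<theta>)\<bar>"
    unfolding wave_defect_def mult.assoc by (rule abs_triangle_ineq4)
  also have "\<dots> \<le> 12 / L * 1 + 6 * k * (1 / L) * 1"
    unfolding abs_mult[of _ "cos _"] abs_mult[of _ "sin _"] abs_mult[of "6 * k"] using 1 k b L1
    by (intro add_mono mult_mono) auto
  also have "\<dots> = (12 + 6 * k) / L" by (simp add: add_divide_distrib)
  finally show ?thesis .
qed

lemma bump_lower:
  assumes L: "L > 0" and t: "t \<in> {a + L / 4..a + 3 * L / 4}"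
  shows "(3 / 16) ^ n \<le> bump n a L t"
proof -
  \<comment> \<open>At the quarter points the normalised parabola has the value
    \<open>1 / 4 * (3 / 4)\<close>, so the difference factors with these points as roots.\<close>
  have "(t - a) * (a + L - t) - 3 / 16 * L\<^sup>2 = (t - (a + L / 4)) * (a + 3 * L / 4 - t)"
    by (simp add: power2_eq_square field_simps)
  also have "\<dots> \<ge> 0" using t by (intro mult_nonneg_nonneg) auto
  finally have "3 / 16 \<le> bump_base a L t" using L by (simp add: bump_base_def field_simps)
  then show ?thesis unfolding bump_def by (intro power_mono) auto
qed

text \<open>Otherwise each step of length \<open>L\<close> more than doubles \<open>r\<close>, so
  \<open>r\<close> is unbounded along \<open>1 + m * L\<close>. But then also
  \<open>r a < r (a + L) - r a \<le> c * L\<close> for every \<open>a \<ge> 1\<close>, a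
  contradiction.\<close>

lemma ex_doubling_interval:
  fixes r :: "real \<Rightarrow> real"
  assumes pos: "r 1 > 0" and mono: "\<And>s t. 1 \<le> s \<Longrightarrow> s \<le> t \<Longrightarrow> r s \<le> r t"
    and lip: "\<And>s t. 1 \<le> s \<Longrightarrow> s \<le> t \<Longrightarrow> r t - r s \<le> c * (t - s)" and L: "L > 0"
  shows "\<exists>a\<ge>1. r (a + L) \<le> 2 * r a"
proof (rule ccontr)
  assume "\<not> ?thesis"
  then have big: "2 * r a < r (a + L)" if "a \<ge> 1" for a
    using that by (meson not_le)
  have grow: "real (Suc m) * r 1 \<le> r (1 + real m * L)" for m
  proof (induction m)
    case (Suc m)
    have a: "1 + real m * L \<ge> 1" using L by simp
    have "2 * r (1 + real m * L) \<le> r (1 + real m * L + L)" using big[OF a] by simp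
    moreover have "r 1 \<le> r (1 + real m * L)" by (rule mono) (use a in simp_all)
    ultimately show ?case using Suc by (simp add: algebra_simps)
  qed simp
  have bound: "r a \<le> c * L" if "a \<ge> 1" for a
    using big[OF that] lip[OF that, of "a + L"] L by simp
  obtain m where "c * L < real m * r 1"
    using reals_Archimedean3[OF pos] by blast
  moreover have "real (Suc m) * r 1 \<le> c * L"
    using grow[of m] bound[of "1 + real m * L"] L by fastforce
  ultimately show False using pos by (simp add: algebra_simps)
qed

section \<open>Long waves against a bounded inverse\<close>

theorem theorem2:
  fixes r r' :: "real \<Rightarrow> real" and c :: real and G :: "real^'n \<Rightarrow> real^'n^'n"
  assumes "CARD('n) \<ge> 2"
    and "model_manifold r G"
    and "\<And>t. t \<ge> 0 \<Longrightarrow> (r has_real_derivative r' t) (at t within {0..})"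
    and "\<And>t. t \<ge> 0 \<Longrightarrow> 0 < r' t \<and> r' t \<le> c"
  shows "laplace_spectrum G = {0..}"
proof -
  note card = assms(1) and M = assms(2)
  have r': "(r has_real_derivative r' t) (at t)" if "t > 0" for t
    using assms(3)[of t] that at_within_interior[of t "{0..}"] by (simp add: interior_Ici[of 0])
  \<comment> \<open>Continuity of \<open>r'\<close> is inherited from the derivatives
    \<open>D\<close> provided by smoothness: by uniqueness \<open>D 1\<close> agrees with
    \<open>r'\<close> for \<open>t > 0\<close>.\<close>
  have cr': "continuous_on {0<..} r'"
  proof -
    have "smooth_on_halfline r" using M unfolding model_manifold_def by (elim conjE)
    then obtain D where D: "D 0 = r" "\<And>k t. t \<ge> 0 \<Longrightarrow> (D k has_real_derivative D (Suc k) t) (at t within {0..})"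
      unfolding smooth_on_halfline_def by blast
    have "continuous_on {0..} (D 1)"
      by (rule DERIV_continuous_on[of _ _ "D 2"]) (use D(2)[of _ 1] in \<open>simp add: numeral_2_eq_2\<close>)
    then have "continuous_on {0<..} (D 1)" by (rule continuous_on_subset) auto
    moreover have "D 1 t = r' t" if "t \<in> {0<..}" for t
    proof (rule DERIV_unique)
      show "(r has_real_derivative D 1 t) (at t)"
        using D(2)[of t 0] that at_within_interior[of t "{0..}"] by (simp add: interior_Ici[of 0] D(1))
    qed (use r' that in simp)
    ultimately show ?thesis by (rule continuous_on_eq)
  qed
  have c: "c > 0" using assms(4)[of 0] by simp
  have "\<forall>t>0. r t > 0" using M unfolding model_manifold_def by (elim conjE)
  then have pos: "r t > 0" if "t > 0" for t using that by blast
  have mvt: "r s \<le> r t \<and> r t - r s \<le> c * (t - s)" if "1 \<le> s" "s \<le> t" for s t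
  proof (cases "s = t")
    case False
    then have "s < t" using that by simp
    then have "\<exists>z. s < z \<and> z < t \<and> r t - r s = (t - s) * r' z"
      by (rule MVT2) (rule r', use that in linarith)
    then obtain z where z: "s < z" "r t - r s = (t - s) * r' z" by blast
    then have "0 < r' z" "r' z \<le> c" using assms(4)[of z] that by auto
    then have "0 \<le> (t - s) * r' z" "(t - s) * r' z \<le> (t - s) * c"
      using that by (auto intro: mult_left_mono)
    then show ?thesis using z by (simp add: mult.commute)
  qed simp
  define N where "N = CARD('n) - 1"
  have "\<not> has_bounded_inverse (volume_measure G) (\<lambda>f h. laplace_graph G f (\<lambda>x. h x - complex_of_real l * f x))"
    if l: "l \<ge> 0" for l
  proof
    assume "has_bounded_inverse (volume_measure G) (\<lambda>f h. laplace_graph G f (\<lambda>x. h x - complex_of_real l * f x))"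
    then obtain K where K: "K \<ge> 0"
      and KI: "\<And>f h. laplace_graph G f (\<lambda>x. h x - complex_of_real l * f x) \<Longrightarrow>
        f \<in> L2 (volume_measure G) \<Longrightarrow> h \<in> L2 (volume_measure G) \<Longrightarrow>
        (L2_norm (volume_measure G) f)\<^sup>2 \<le> K * (L2_norm (volume_measure G) h)\<^sup>2"
      by (rule has_bounded_inverseE) blast
    define k where "k = sqrt l"
    have k: "k \<ge> 0" "k\<^sup>2 = l" using l by (auto simp: k_def)
    \<comment> \<open>Up to the factor \<open>(2 * r a)^N\<close>, \<open>E\<close> bounds the
      integral of the squared \<open>\<Delta> u + l u\<close>: the first summand comes from the
      cut-off, the second from the first-order term with \<open>r' / r\<close>. It depends on
      neither \<open>a\<close> nor \<open>L\<close>.\<close>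
    define E where "E = 2 * (12 + 6 * k)\<^sup>2 + 2 * (real N)\<^sup>2 * (3 + k)\<^sup>2 * (c / r 1)"
    have E: "E \<ge> 0" using c pos[of 1] by (simp add: E_def)
    \<comment> \<open>Chosen so that \<open>b * L = b + 2 * (2 * K * 2^N * E)\<close>, where
      \<open>b = ((3 / 16)^3)^2\<close> bounds the squared bump below; this exceeds by
      \<open>b\<close> the upper bound derived at the end. The length is fixed before the position
      \<open>a\<close>.\<close>
    define L where "L = 1 + 2 * (2 * K * 2 ^ N * E) / ((3 / 16) ^ 3)\<^sup>2"
    have L: "L \<ge> 1" using K E by (simp add: L_def)
    obtain a where a: "a \<ge> 1" "r (a + L) \<le> 2 * r a"
      using ex_doubling_interval[of r c L] pos[of 1] mvt L by force
    have ra: "r a > 0" "r 1 \<le> r a" using pos[of a] mvt[of 1 a] a by auto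
    let ?w = "\<lambda>t. indicator {0<..} t :: real"
    define lap where "lap \<theta> = radial_laplace N r r' (wave' k \<theta> a L) (\<lambda>t. wave_defect k \<theta> a L t - k\<^sup>2 * wave k \<theta> a L t)" for \<theta>
    define J where "J \<theta> t = ?w t * (r t ^ N * (wave k \<theta> a L t)\<^sup>2)" for \<theta> t
    define H where "H \<theta> t = ?w t * (r t ^ N * (lap \<theta> t + l * wave k \<theta> a L t)\<^sup>2)" for \<theta> t
    have cw: "continuous_on S (\<lambda>t. wave_defect k \<theta> a L t - k\<^sup>2 * wave k \<theta> a L t)" for S \<theta>
      by (intro continuous_on_diff continuous_on_mult continuous_on_const continuous_on_wave_defect
          DERIV_continuous_on[OF has_field_derivative_at_within[OF DERIV_wave]])
    have supp: "wave k \<theta> a L t = 0 \<and> wave' k \<theta> a L t = 0 \<and> wave_defect k \<theta> a L t - k\<^sup>2 * wave k \<theta> a L t = 0"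
      if "t \<notin> {a..a+L}" for \<theta> t
      using wave_eq_0[of L t a] that L by auto
    have a0: "a > 0" using a by simp
    \<comment> \<open>These facts instantiate the context of Green's identity with the wave on
      \<open>[a, a + L]\<close>; its second derivative is the defect minus \<open>k^2\<close> times
      the wave.\<close>
    note ctx = M card N_def r' cr' a0 DERIV_wave DERIV_wave' cw supp
    have JH: "(\<integral>t. J \<theta> t \<partial>lborel) \<le> K * (\<integral>t. H \<theta> t \<partial>lborel)" for \<theta>
      unfolding J_def H_def lap_def using radial_spectral_bound[OF ctx KI] unfolding N_def[symmetric] .
    have lapeq: "lap \<theta> t + l * wave k \<theta> a L t = wave_defect k \<theta> a L t + real N * (r' t / r t) * wave' k \<theta> a L t" for \<theta> t
      by (simp add: lap_def radial_laplace_def k(2))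
    have iH: "integrable lborel (H \<theta>)" and iJ: "integrable lborel (J \<theta>)" for \<theta>
    proof -
      have cwv: "continuous_on {0<..} (wave k \<theta> a L)"
        by (rule DERIV_continuous_on[OF has_field_derivative_at_within[OF DERIV_wave]])
      have clap: "continuous_on {0<..} (lap \<theta>)"
        unfolding lap_def by (rule continuous_on_radial_laplacian[OF ctx])
      have lap0: "lap \<theta> t = 0" if "t \<notin> {a..a+L}" for t
        unfolding lap_def by (rule radial_laplacian_eq_0[OF ctx that])
      show "integrable lborel (H \<theta>)" unfolding H_def
      proof (rule integrable_radial[OF ctx])
        show "continuous_on {0<..} (\<lambda>t. (lap \<theta> t + l * wave k \<theta> a L t)\<^sup>2)"
          by (intro continuous_intros clap cwv)
        show "(lap \<theta> t + l * wave k \<theta> a L t)\<^sup>2 = 0" if "t \<notin> {a..a+L}" for t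
          using lap0[OF that] supp[OF that] by simp
      qed
      show "integrable lborel (J \<theta>)" unfolding J_def
      proof (rule integrable_radial[OF ctx])
        show "continuous_on {0<..} (\<lambda>t. (wave k \<theta> a L t)\<^sup>2)"
          by (intro continuous_intros cwv)
        show "(wave k \<theta> a L t)\<^sup>2 = 0" if "t \<notin> {a..a+L}" for t
          using supp[OF that] by simp
      qed
    qed
    have upper: "(\<integral>t. H \<theta> t \<partial>lborel) \<le> (2 * r a) ^ N * E" for \<theta>
    proof -
      \<comment> \<open>The square of \<open>\<Delta> u + l u\<close> is bounded pointwise by
        \<open>P + Q * r' t\<close>. Keeping one factor \<open>r' t\<close> lets the second term
        integrate to \<open>Q * (r (a + L) - r a)\<close>, which doubling controls independently of
        \<open>L\<close>.\<close>
      define P where "P = 2 * ((12 + 6 * k) / L)\<^sup>2"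
      define Q where "Q = 2 * (real N)\<^sup>2 * (3 + k)\<^sup>2 * (c / r 1) / r a"
      have PQ: "P \<ge> 0" "Q \<ge> 0" using c pos[of 1] ra by (auto simp: P_def Q_def)
      let ?g = "\<lambda>t. (2 * r a) ^ N * (P + Q * r' t)"
      have g: "has_bochner_integral lborel (\<lambda>t. ?g t * indicator {a..a+L} t)
          ((2 * r a) ^ N * (P * (a + L) + Q * r (a + L)) - (2 * r a) ^ N * (P * a + Q * r a))"
      proof (rule has_bochner_integral_FTC_Icc_real)
        show "((\<lambda>t. (2 * r a) ^ N * (P * t + Q * r t)) has_real_derivative ?g t) (at t)" if "a \<le> t" for t
          using that a0 by (auto intro!: derivative_eq_intros r')
        show "isCont ?g t" if "a \<le> t" for t
        proof -
          have "isCont r' t"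
            using cr' that a0 by (subst (asm) continuous_on_eq_continuous_at) auto
          then show ?thesis by (intro continuous_intros)
        qed
      qed (use L in simp)
      have "H \<theta> t \<le> ?g t * indicator {a..a+L} t" for t
      proof (cases "t \<in> {a..a+L}")
        case True
        then have t: "t \<ge> a" "t \<le> a + L" "t \<ge> 1" "t > 0" using a by auto
        have rt: "r a \<le> r t" "r t \<le> 2 * r a" "r 1 \<le> r t" "r t > 0"
          using mvt[of a t] mvt[of t "a + L"] mvt[of 1 t] t a pos by auto
        have r't: "0 < r' t" "r' t \<le> c" using assms(4)[of t] t by auto
        let ?q = "r' t / r t"
        \<comment> \<open>One factor \<open>r' t\<close> is estimated by \<open>c\<close> and the
          other is kept; below, one \<open>r t\<close> is replaced by \<open>r 1\<close> and the
          other by \<open>r a\<close>.\<close>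
        have "?q\<^sup>2 = r' t * r' t / (r t * r t)" by (simp add: power2_eq_square)
        also have "\<dots> \<le> c * r' t / (r 1 * r a)"
          using rt r't ra pos[of 1] by (intro frac_le mult_mono mult_pos_pos) auto
        finally have q: "?q\<^sup>2 \<le> c / r 1 * (r' t / r a)" by (simp add: field_simps)
        define A where "A = wave_defect k \<theta> a L t"
        define B where "B = wave' k \<theta> a L t"
        have A: "A\<^sup>2 \<le> ((12 + 6 * k) / L)\<^sup>2"
          using power_mono[OF wave_defect_bound[OF L k(1), of \<theta> a t], of 2] by (simp add: A_def)
        have B: "B\<^sup>2 \<le> (3 + k)\<^sup>2"
          using power_mono[OF wave'_bound[OF L k(1), of \<theta> a t], of 2] by (simp add: B_def)
        have square_sum: "(x + y)\<^sup>2 \<le> 2 * x\<^sup>2 + 2 * y\<^sup>2" for x y :: real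
          using zero_le_power2[of "x - y"] by (simp add: power2_sum power2_diff)
        have "(A + real N * ?q * B)\<^sup>2 \<le> 2 * A\<^sup>2 + 2 * (real N * ?q * B)\<^sup>2"
          by (rule square_sum)
        also have "\<dots> = 2 * A\<^sup>2 + 2 * (real N)\<^sup>2 * (?q\<^sup>2 * B\<^sup>2)" by (simp only: power_mult_distrib mult.assoc)
        also have "\<dots> \<le> P + 2 * (real N)\<^sup>2 * (c / r 1 * (r' t / r a) * (3 + k)\<^sup>2)"
          unfolding P_def using A B q r't ra c pos[of 1] by (intro add_mono mult_left_mono mult_mono) auto
        also have "\<dots> = P + Q * r' t" by (simp add: Q_def)
        finally have "(A + real N * ?q * B)\<^sup>2 \<le> P + Q * r' t" .
        then have "r t ^ N * (A + real N * ?q * B)\<^sup>2 \<le> (2 * r a) ^ N * (P + Q * r' t)"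
          using rt by (intro mult_mono power_mono) auto
        then show ?thesis using True t by (simp add: H_def lapeq A_def B_def)
      next
        case False
        have "lap \<theta> t + l * wave k \<theta> a L t = 0"
          unfolding lapeq using wave_eq_0[of L t a] False L by simp
        then show ?thesis using False by (simp add: H_def)
      qed
      then have "(\<integral>t. H \<theta> t \<partial>lborel) \<le> (\<integral>t. ?g t * indicator {a..a+L} t \<partial>lborel)"
        using iH g by (intro integral_mono) (auto simp: has_bochner_integral_iff)
      also have "\<dots> = (2 * r a) ^ N * (P * L + Q * (r (a + L) - r a))"
        using g by (simp add: has_bochner_integral_iff algebra_simps)
      also have "\<dots> \<le> (2 * r a) ^ N * E"
      proof (rule mult_left_mono)
        have "P * L = 2 * (12 + 6 * k)\<^sup>2 / L" using L by (simp add: P_def power_divide power2_eq_square)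
        also have "\<dots> \<le> 2 * (12 + 6 * k)\<^sup>2 / 1" using L by (intro divide_left_mono) auto
        finally have "P * L \<le> 2 * (12 + 6 * k)\<^sup>2" by simp
        \<comment> \<open>The choice of \<open>a\<close> bounds the increment of \<open>r\<close> by
          \<open>r a\<close>, which cancels the denominator of \<open>Q\<close>.\<close>
        moreover have "Q * (r (a + L) - r a) \<le> Q * r a"
          using a PQ by (intro mult_left_mono) auto
        moreover have "Q * r a = 2 * (real N)\<^sup>2 * (3 + k)\<^sup>2 * (c / r 1)"
          using ra by (simp add: Q_def)
        ultimately show "P * L + Q * (r (a + L) - r a) \<le> E" unfolding E_def by linarith
      qed (use ra in simp)
      finally show ?thesis .
    qed
    define b :: real where "b = ((3 / 16) ^ 3)\<^sup>2"
    have b: "b > 0" by (simp add: b_def)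
    \<comment> \<open>The middle half of the interval, where the bump has a lower bound independent
      of \<open>L\<close>.\<close>
    let ?I = "{a + L / 4..a + 3 * L / 4}"
    have lower: "r a ^ N * b * (L / 2) \<le> (\<integral>t. J 0 t \<partial>lborel) + (\<integral>t. J (- (pi / 2)) t \<partial>lborel)"
    proof -
      have "r a ^ N * b * indicator ?I t \<le> J 0 t + J (- (pi / 2)) t" for t
      proof (cases "t \<in> ?I")
        case True
        then have t: "t \<ge> a" "t > 0" using a0 L by auto
        have "((3 / 16) ^ 3)\<^sup>2 \<le> (bump 3 a L t)\<^sup>2"
          by (rule power_mono[OF bump_lower]) (use True L in auto)
        moreover have "r a ^ N \<le> r t ^ N" using mvt[of a t] a t ra by (intro power_mono) auto
        ultimately have "r a ^ N * b \<le> r t ^ N * (bump 3 a L t)\<^sup>2"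
          unfolding b_def using pos[OF t(2)] by (intro mult_mono) auto
        \<comment> \<open>Since \<open>cos (k * t - pi / 2) = sin (k * t)\<close>, the squares of
          the two waves add up to the squared bump, so zeros of a single wave do no harm.\<close>
        also have "\<dots> = r t ^ N * (bump 3 a L t)\<^sup>2 * ((cos (k * t))\<^sup>2 + (sin (k * t))\<^sup>2)" by simp
        also have "\<dots> = J 0 t + J (- (pi / 2)) t"
          using t by (simp add: J_def wave_def cos_diff power_mult_distrib algebra_simps del: sin_cos_squared_add sin_cos_squared_add2)
        finally show ?thesis using True by simp
      next
        case False
        have "0 \<le> J \<theta> t" for \<theta> using pos[of t] by (auto simp: J_def indicator_def)
        then show ?thesis using False by simp
      qed
      moreover have "has_bochner_integral lborel (\<lambda>t. r a ^ N * b * indicator ?I t) (r a ^ N * b * measure lborel ?I)"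
        using emeasure_bounded_finite[of ?I]
        by (intro has_bochner_integral_mult_right has_bochner_integral_real_indicator) auto
      ultimately have "r a ^ N * b * measure lborel ?I \<le> (\<integral>t. J 0 t + J (- (pi / 2)) t \<partial>lborel)"
        using iJ integral_mono[of lborel "\<lambda>t. r a ^ N * b * indicator ?I t" "\<lambda>t. J 0 t + J (- (pi / 2)) t"]
        by (simp add: has_bochner_integral_iff)
      moreover have "measure lborel ?I = L / 2" using L by simp
      ultimately show ?thesis
        unfolding Bochner_Integration.integral_add[OF iJ iJ] by (simp only:)
    qed
    have "r a ^ N * (b * (L / 2)) \<le> K * ((2 * r a) ^ N * E) + K * ((2 * r a) ^ N * E)"
      using lower JH[of 0] JH[of "- (pi / 2)"] mult_left_mono[OF upper[of 0] K]
        mult_left_mono[OF upper[of "- (pi / 2)"] K] unfolding mult.assoc by linarith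
    also have "\<dots> = r a ^ N * (2 * K * 2 ^ N * E)" by (simp add: power_mult_distrib)
    \<comment> \<open>The factor \<open>r a ^ N\<close>, the last trace of the position of the
      interval, cancels.\<close>
    finally have "b * (L / 2) \<le> 2 * K * 2 ^ N * E"
      using ra by simp
    then have "b * L \<le> 2 * (2 * K * 2 ^ N * E)" by simp
    moreover have "b * L = b + 2 * (2 * K * 2 ^ N * E)"
      unfolding L_def b_def by (simp add: field_simps)
    ultimately show False using b by simp
  qed
  then show ?thesis unfolding laplace_spectrum_def by auto
qed

end
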